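(* Let $f\colon\mathbb{D}\to\mathbb{D}$ be a non-elliptic map with Denjoy--Wolff point $\tau\in\partial\mathbb{D}$, Koenigs function $h$ and Koenigs domain $\Omega$. Let $V\subseteq\mathbb{D}$ be a fundamental domain of $f$ with the following properties: $h$ is univalent on $V$; $h(V)$ is starlike at infinity; $\bigcup_{t\geq0}( h(V)-t)=\bigcup_{n\in\mathbb{N}}( \Omega-n)$; and, if $f$ is hyperbolic or parabolic of zero hyperbolic step, then any sequence $\{z_n\}\subseteq\mathbb{D}$ converging non-tangentially to $\tau$ is eventually contained in $V$ and satisfies $\lim_{n\to+\infty}\lambda_{\mathbb{D}}(z_n)/\lambda_V(z_n)=1$. Let $(\phi_t)_{t\ge0}$ be the semigroup-fication of $f$ in $V$, that is, the semigroup in $V$ given by $$\phi_t(z)=(h|_V)^{-1}\left(h|_V(z)+t\right),\quad z\in V,\ t\ge0.$$ Then: (a) $\phi_1\equiv f|_V$ and $\phi_n(z)=f^n(z)$, for any $z\in V$ and all $n\in\mathbb{N}$; (b) $f$ and $(\phi_t)$ have the same type (hyperbolic, parabolic of zero hyperbolic step or parabolic of positive hyperbolic step); (c) $\lim_{t\to+\infty}|\phi_t(z)-\tau|=0$, for all $z\in V$; and (d) for any $z\in V$, $\{f^n(z)\}$ converges to $\tau$ non-tangentially if and only if $\phi_t(z)$ converges to $\tau$ non-tangentially in $\mathbb{D}$ as $t\to+\infty$.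
   Context: $\mathbb{D}$ is the open unit disc and $\mathbb{N}=\{1,2,\dots\}$. A holomorphic map $f\colon\mathbb{D}\to\mathbb{D}$ is non-elliptic if it has no fixed point in $\mathbb{D}$; then there is a unique $\tau\in\partial\mathbb{D}$, the Denjoy--Wolff point of $f$, such that the iterates $f^n(z)$ converge to $\tau$ for all $z\in\mathbb{D}$. A domain $\Omega\subseteq\mathbb{C}$ is starlike at infinity if $\Omega+t\subseteq\Omega$ for all $t\ge 0$; it is asymptotically starlike at infinity if $\Omega+1\subseteq\Omega$ and $\widetilde{\Omega}:=\bigcup_{n=1}^\infty(\Omega-n)$ is starlike at infinity. A simply connected domain $U\subseteq\mathbb{D}$ is a fundamental domain of $f$ if $f$ is univalent on $U$, $f(U)\subseteq U$ and $\bigcup_{n\in\mathbb{N}}f^{-n}(U)=\mathbb{D}$, where $f^{-n}(U)$ is the preimage of $U$ under $f^n$. For a non-elliptic $f$, a Koenigs domain and a Koenigs function are a domain $\Omega$ asymptotically starlike at infinity and an onto holomorphic map $h\colon\mathbb{D}\to\Omega$ with $h\circ f=h+1$ and such that $h$ is univalent on some fundamental domain of $f$. Such a pair exists and is unique up to translation. The map $f$ is hyperbolic if $\widetilde{\Omega}$ is a horizontal strip, parabolic of positive hyperbolic step if $\widetilde\Omega$ is a horizontal half-plane, and parabolic of zero hyperbolic step if $\widetilde\Omega=\mathbb{C}$; these are the only possibilities. A semigroup in a simply connected domain $D\subsetneq\mathbb{C}$ is a family $(\phi_t)_{t\ge0}$ of holomorphic maps $\phi_t\colon D\to D$ with $\phi_0=\mathrm{Id}_D$,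 $\phi_{t+s}=\phi_t\circ\phi_s$, and $\lim_{t\to0}\phi_t(z)=z$ for all $z\in D$. It is non-elliptic if its trajectories converge, as $t\to+\infty$, to a prime end of $D$ (in the Carathéodory topology). A non-elliptic semigroup in $D$ has a Koenigs domain $\Omega'\subsetneq\mathbb{C}$, starlike at infinity, and a univalent Koenigs function $g\colon D\to\Omega'$ with $g(D)=\Omega'$ and $g(\phi_t(z))=g(z)+t$ for all $z\in D,\ t\ge0$; the pair is unique up to translation. The semigroup is hyperbolic, parabolic of positive hyperbolic step, or parabolic of zero hyperbolic step according to whether $\bigcup_{t\ge0}(\Omega'-t)$ is a horizontal strip, a horizontal half-plane, or $\mathbb{C}$. A sequence $\{z_n\}\subseteq\mathbb{D}$ (respectively a curve $\gamma\colon[0,+\infty)\to\mathbb{D}$) converging to $\sigma\in\partial\mathbb{D}$ converges non-tangentially if there is $R>1$ such that it is contained in $\{z\in\mathbb{D}:|\sigma-z|<R(1-|z|)\}$. The hyperbolic metric is $\lambda_{\mathbb{D}}(z)|dz|=\frac{|dz|}{1-|z|^2}$, and for a simply connected domain $D\subsetneq\mathbb{C}$, $\lambda_D$ is given by $\lambda_D(\pi(z))|\pi'(z)|=\lambda_{\mathbb{D}}(z)$ for any Riemann map $\pi\colon\mathbb{D}\to D$. *)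

theory Defs
  imports "HOL-Complex_Analysis.Complex_Analysis"
begin

abbreviation unit_disc :: "complex set"
  where "unit_disc \<equiv> ball 0 1"

definition is_domain :: "complex set \<Rightarrow> bool"
  where "is_domain D \<longleftrightarrow> open D \<and> connected D \<and> D \<noteq> {}"

definition univalent_on :: "(complex \<Rightarrow> complex) \<Rightarrow> complex set \<Rightarrow> bool"
  where "univalent_on f D \<longleftrightarrow> f holomorphic_on D \<and> inj_on f D"

section \<open>Non-elliptic self-maps of the disc\<close>

definition non_elliptic_map :: "(complex \<Rightarrow> complex) \<Rightarrow> bool"
  where "non_elliptic_map f \<longleftrightarrow>
    f holomorphic_on unit_disc \<and> f ` unit_disc \<subseteq> unit_disc \<and> (\<forall>z\<in>unit_disc. f z \<noteq> z)"

definition denjoy_wolff_point :: "(complex \<Rightarrow> complex) \<Rightarrow> complex \<Rightarrow> bool"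
  where "denjoy_wolff_point f \<tau> \<longleftrightarrow>
    \<tau> \<in> sphere 0 1 \<and> (\<forall>z\<in>unit_disc. (\<lambda>n. (f ^^ n) z) \<longlonglongrightarrow> \<tau>)"

definition starlike_at_infinity :: "complex set \<Rightarrow> bool"
  where "starlike_at_infinity \<Omega> \<longleftrightarrow>
    is_domain \<Omega> \<and> (\<forall>t\<ge>0. (\<lambda>w. w + complex_of_real t) ` \<Omega> \<subseteq> \<Omega>)"

definition discrete_hull :: "complex set \<Rightarrow> complex set"
  where "discrete_hull \<Omega> = (\<Union>n\<in>{1::nat..}. (\<lambda>w. w - of_nat n) ` \<Omega>)"

definition continuous_hull :: "complex set \<Rightarrow> complex set"
  where "continuous_hull \<Omega> = (\<Union>t\<in>{0::real..}. (\<lambda>w. w - of_real t) ` \<Omega>)"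

definition asymptotically_starlike_at_infinity :: "complex set \<Rightarrow> bool"
  where "asymptotically_starlike_at_infinity \<Omega> \<longleftrightarrow>
    is_domain \<Omega> \<and> (\<lambda>w. w + 1) ` \<Omega> \<subseteq> \<Omega> \<and> starlike_at_infinity (discrete_hull \<Omega>)"

definition fundamental_domain :: "(complex \<Rightarrow> complex) \<Rightarrow> complex set \<Rightarrow> bool"
  where "fundamental_domain f U \<longleftrightarrow>
    is_domain U \<and> simply_connected U \<and> U \<subseteq> unit_disc \<and> univalent_on f U \<and> f ` U \<subseteq> U \<and>
    (\<Union>n\<in>{1::nat..}. {z \<in> unit_disc. (f ^^ n) z \<in> U}) = unit_disc"

definition koenigs_pair ::
    "(complex \<Rightarrow> complex) \<Rightarrow> (complex \<Rightarrow> complex) \<Rightarrow> complex set \<Rightarrow> bool"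
  where "koenigs_pair f h \<Omega> \<longleftrightarrow>
    asymptotically_starlike_at_infinity \<Omega> \<and>
    h holomorphic_on unit_disc \<and> h ` unit_disc = \<Omega> \<and>
    (\<forall>z\<in>unit_disc. h (f z) = h z + 1) \<and>
    (\<exists>U. fundamental_domain f U \<and> univalent_on h U)"

definition horizontal_strip :: "complex set \<Rightarrow> bool"
  where "horizontal_strip S \<longleftrightarrow> (\<exists>a b. a < b \<and> S = {w. a < Im w \<and> Im w < b})"

definition horizontal_half_plane :: "complex set \<Rightarrow> bool"
  where "horizontal_half_plane S \<longleftrightarrow> (\<exists>a. S = {w. a < Im w} \<or> S = {w. Im w < a})"

text \<open>A Koenigs pair is unique up to translation, so the existential quantifiers below
  (and in the corresponding definitions for semigroups) could equally well be universal.\<close>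

definition hyperbolic_map :: "(complex \<Rightarrow> complex) \<Rightarrow> bool"
  where "hyperbolic_map f \<longleftrightarrow> non_elliptic_map f \<and>
    (\<exists>h \<Omega>. koenigs_pair f h \<Omega> \<and> horizontal_strip (discrete_hull \<Omega>))"

definition parabolic_pos_step_map :: "(complex \<Rightarrow> complex) \<Rightarrow> bool"
  where "parabolic_pos_step_map f \<longleftrightarrow> non_elliptic_map f \<and>
    (\<exists>h \<Omega>. koenigs_pair f h \<Omega> \<and> horizontal_half_plane (discrete_hull \<Omega>))"

definition parabolic_zero_step_map :: "(complex \<Rightarrow> complex) \<Rightarrow> bool"
  where "parabolic_zero_step_map f \<longleftrightarrow> non_elliptic_map f \<and>
    (\<exists>h \<Omega>. koenigs_pair f h \<Omega> \<and> discrete_hull \<Omega> = UNIV)"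

section \<open>Prime ends\<close>

text \<open>Prime ends are taken with respect to the Riemann sphere, since the domain may be
  unbounded: a crosscut may land at infinity, diameters are measured in the chordal metric,
  and two sets have disjoint closures in the sphere iff their closures in the plane
  are disjoint and they are not both unbounded.\<close>

definition chordal_dist :: "complex \<Rightarrow> complex \<Rightarrow> real"
  where "chordal_dist z w = 2 * cmod (z - w) / (sqrt (1 + (cmod z)\<^sup>2) * sqrt (1 + (cmod w)\<^sup>2))"

definition lands_on_boundary :: "complex set \<Rightarrow> (real \<Rightarrow> complex) \<Rightarrow> real filter \<Rightarrow> bool"
  where "lands_on_boundary D \<gamma> F \<longleftrightarrow>
    (\<exists>a\<in>frontier D. (\<gamma> \<longlongrightarrow> a) F) \<or> filterlim \<gamma> at_infinity F"

definition crosscut :: "complex set \<Rightarrow> complex set \<Rightarrow> bool"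
  where "crosscut D C \<longleftrightarrow>
    (\<exists>\<gamma>. continuous_on {0<..<1} \<gamma> \<and> inj_on \<gamma> {0<..<1} \<and> \<gamma> ` {0<..<1} = C \<and> C \<subseteq> D \<and>
         lands_on_boundary D \<gamma> (at_right 0) \<and> lands_on_boundary D \<gamma> (at_left 1))"

definition separates_in :: "complex set \<Rightarrow> complex set \<Rightarrow> complex set \<Rightarrow> complex set \<Rightarrow> bool"
  where "separates_in D C A B \<longleftrightarrow>
    A \<subseteq> D - C \<and> B \<subseteq> D - C \<and> (\<forall>a\<in>A. \<forall>b\<in>B. \<not> connected_component (D - C) a b)"

definition null_chain :: "complex set \<Rightarrow> (nat \<Rightarrow> complex set) \<Rightarrow> bool"
  where "null_chain D C \<longleftrightarrow>
    (\<forall>n. crosscut D (C n)) \<and>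
    (\<forall>n. closure (C n) \<inter> closure (C (Suc n)) = {} \<and> (bounded (C n) \<or> bounded (C (Suc n)))) \<and>
    (\<forall>n\<ge>1. separates_in D (C n) (C 0) (C (Suc n))) \<and>
    (\<forall>\<epsilon>>0. \<forall>\<^sub>F n in sequentially. \<forall>z\<in>C n. \<forall>w\<in>C n. chordal_dist z w < \<epsilon>)"

text \<open>A prime end is an equivalence class of null chains; a curve in the domain converges to the
  prime end represented by the null chain \<open>C\<close> iff, for every \<open>n \<ge> 1\<close>, it is eventually
  contained in the component of \<open>D - C n\<close> that does not contain \<open>C 0\<close>. This does not depend on
  the representative.\<close>

definition converges_to_prime_end ::
    "complex set \<Rightarrow> (nat \<Rightarrow> complex set) \<Rightarrow> (real \<Rightarrow> complex) \<Rightarrow> bool"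
  where "converges_to_prime_end D C \<gamma> \<longleftrightarrow>
    (\<forall>n\<ge>1. \<forall>\<^sub>F t in at_top. separates_in D (C n) (C 0) {\<gamma> t})"

section \<open>Semigroups\<close>

definition semigroup_in :: "complex set \<Rightarrow> (real \<Rightarrow> complex \<Rightarrow> complex) \<Rightarrow> bool"
  where "semigroup_in D \<phi> \<longleftrightarrow>
    is_domain D \<and> simply_connected D \<and> D \<noteq> UNIV \<and>
    (\<forall>t\<ge>0. \<phi> t holomorphic_on D \<and> \<phi> t ` D \<subseteq> D) \<and>
    (\<forall>z\<in>D. \<phi> 0 z = z) \<and>
    (\<forall>t\<ge>0. \<forall>s\<ge>0. \<forall>z\<in>D. \<phi> (t + s) z = \<phi> t (\<phi> s z)) \<and>
    (\<forall>z\<in>D. ((\<lambda>t. \<phi> t z) \<longlongrightarrow> z) (at_right 0))"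

definition non_elliptic_semigroup :: "complex set \<Rightarrow> (real \<Rightarrow> complex \<Rightarrow> complex) \<Rightarrow> bool"
  where "non_elliptic_semigroup D \<phi> \<longleftrightarrow>
    semigroup_in D \<phi> \<and>
    (\<exists>C. null_chain D C \<and> (\<forall>z\<in>D. converges_to_prime_end D C (\<lambda>t. \<phi> t z)))"

definition semigroup_koenigs_pair ::
    "complex set \<Rightarrow> (real \<Rightarrow> complex \<Rightarrow> complex) \<Rightarrow> (complex \<Rightarrow> complex) \<Rightarrow> complex set \<Rightarrow> bool"
  where "semigroup_koenigs_pair D \<phi> g \<Omega> \<longleftrightarrow>
    starlike_at_infinity \<Omega> \<and> \<Omega> \<noteq> UNIV \<and> univalent_on g D \<and> g ` D = \<Omega> \<and>
    (\<forall>z\<in>D. \<forall>t\<ge>0. g (\<phi> t z) = g z + of_real t)"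

definition hyperbolic_semigroup :: "complex set \<Rightarrow> (real \<Rightarrow> complex \<Rightarrow> complex) \<Rightarrow> bool"
  where "hyperbolic_semigroup D \<phi> \<longleftrightarrow> non_elliptic_semigroup D \<phi> \<and>
    (\<exists>g \<Omega>. semigroup_koenigs_pair D \<phi> g \<Omega> \<and> horizontal_strip (continuous_hull \<Omega>))"

definition parabolic_pos_step_semigroup :: "complex set \<Rightarrow> (real \<Rightarrow> complex \<Rightarrow> complex) \<Rightarrow> bool"
  where "parabolic_pos_step_semigroup D \<phi> \<longleftrightarrow> non_elliptic_semigroup D \<phi> \<and>
    (\<exists>g \<Omega>. semigroup_koenigs_pair D \<phi> g \<Omega> \<and> horizontal_half_plane (continuous_hull \<Omega>))"

definition parabolic_zero_step_semigroup :: "complex set \<Rightarrow> (real \<Rightarrow> complex \<Rightarrow> complex) \<Rightarrow> bool"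
  where "parabolic_zero_step_semigroup D \<phi> \<longleftrightarrow> non_elliptic_semigroup D \<phi> \<and>
    (\<exists>g \<Omega>. semigroup_koenigs_pair D \<phi> g \<Omega> \<and> continuous_hull \<Omega> = UNIV)"

section \<open>Non-tangential convergence and the hyperbolic metric\<close>

definition stolz_region :: "complex \<Rightarrow> real \<Rightarrow> complex set"
  where "stolz_region \<sigma> R = {z \<in> unit_disc. cmod (\<sigma> - z) < R * (1 - cmod z)}"

text \<open>Sequences are indexed by the positive integers; the value at \<open>0\<close> is ignored.\<close>

definition nontangential_seq :: "(nat \<Rightarrow> complex) \<Rightarrow> complex \<Rightarrow> bool"
  where "nontangential_seq z \<sigma> \<longleftrightarrow>
    z \<longlonglongrightarrow> \<sigma> \<and> (\<exists>R>1. \<forall>n\<ge>1. z n \<in> stolz_region \<sigma> R)"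

definition nontangential_curve :: "(real \<Rightarrow> complex) \<Rightarrow> complex \<Rightarrow> bool"
  where "nontangential_curve \<gamma> \<sigma> \<longleftrightarrow>
    (\<gamma> \<longlongrightarrow> \<sigma>) at_top \<and> (\<exists>R>1. \<forall>t\<ge>0. \<gamma> t \<in> stolz_region \<sigma> R)"

definition disc_density :: "complex \<Rightarrow> real"
  where "disc_density z = 1 / (1 - (cmod z)\<^sup>2)"

definition riemann_map :: "complex set \<Rightarrow> (complex \<Rightarrow> complex) \<Rightarrow> bool"
  where "riemann_map D \<pi> \<longleftrightarrow> univalent_on \<pi> unit_disc \<and> \<pi> ` unit_disc = D"

text \<open>Only meaningful at points \<open>w\<close> of a simply connected domain \<open>D \<noteq> UNIV\<close>.\<close>

definition hyperbolic_density :: "complex set \<Rightarrow> complex \<Rightarrow> real"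
  where "hyperbolic_density D w =
    (THE l. \<forall>\<pi> z. riemann_map D \<pi> \<and> z \<in> unit_disc \<and> \<pi> z = w \<longrightarrow>
                  l * cmod (deriv \<pi> z) = disc_density z)"

end

theory Submission
  imports Defs
begin

text \<open>
  In the coordinate \<open>h\<close> the map \<open>f\<close> is the translation by 1 and \<open>\<phi>\<close> is the flow of translations.
  Since \<open>h\<close> is injective on \<open>V\<close>, the time-one map of the flow is \<open>f\<close>, and \<open>\<phi>\<close> at time \<open>t\<close>
  is the iterate of \<open>f\<close> of order \<open>\<lfloor>t\<rfloor>\<close> applied to \<open>\<phi>\<close> at time \<open>frac t\<close>. A trajectory is
  therefore the union of the images of one compact arc under the iterates of \<open>f\<close>.

  By the Schwarz--Pick lemma the iterates do not increase hyperbolic distances. In Euclidean terms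
  (lemma \<open>orbit_comparison\<close>), the image of a compact set under an iterate stays within a fixed
  multiple of the distance to the unit circle from the orbit of one point. Hence the flow
  converges to \<open>\<tau>\<close>, uniformly on compact sets, and passing from integer to real times only
  enlarges the Stolz region; this is (c) and (d).

  For (b), both types are read off from the same set, which is at once the discrete hull of \<open>\<Omega>\<close>
  and the continuous hull of \<open>h ` V\<close>. The types are defined by the existence of some Koenigs pair, so
  the result has to be independent of that pair. For the semigroup, two Koenigs functions differ by
  a translation. For the map it is enough to know that the shape of the hull is the same
  (\<open>discrete_hull_type_unique\<close>): a hull is a union of horizontal lines, two hulls are related by
  holomorphic maps in both directions that commute with \<open>w \<mapsto> w + 1\<close>, and such maps do not exist
  from a half-plane or the plane to a strip, nor from the plane to a half-plane.

  The type of a semigroup presupposes that it is non-elliptic, so a prime end of \<open>V\<close> must be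
  found to which all trajectories converge. One trajectory ends at \<open>\<tau>\<close>, a point of the unit
  circle. Circles about \<open>\<tau>\<close> meet \<open>V\<close> in arcs that are crosscuts, with diameters as small as
  desired and with disjoint closures for different radii. Since \<open>V\<close> is simply connected, one of the
  arcs on each small circle separates a given point of the trajectory from its tail. Choosing the
  arcs recursively, each separating a point of the previous one from the tail, yields a null chain
  (\<open>accessible_point_null_chain\<close>). All trajectories converge to the same prime end, because the flow
  converges to \<open>\<tau>\<close> uniformly on paths in \<open>V\<close>.
\<close>

section \<open>Schwarz--Pick estimates\<close>

text \<open>The right-hand side shows that the pseudo-hyperbolic distance
  \<open>\<bar>a - b\<bar> / \<bar>1 - cnj a * b\<bar>\<close> is less than 1 inside the disc and quantifies by how much.\<close>

lemma disc_norm_identity: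
  fixes a b :: complex
  shows "(cmod (1 - cnj a * b))\<^sup>2 - (cmod (a - b))\<^sup>2 = (1 - (cmod a)\<^sup>2) * (1 - (cmod b)\<^sup>2)"
  by (cases a; cases b) (simp add: cmod_power2, simp add: power2_eq_square algebra_simps)

text \<open>The Schwarz lemma applied to \<open>F\<close>, conjugated by the disc automorphisms that carry \<open>a\<close> and
  \<open>F a\<close> to the origin; the inequality of pseudo-hyperbolic distances is stated without
  quotients.\<close>

lemma schwarz_pick:
  assumes F: "F holomorphic_on unit_disc" "F ` unit_disc \<subseteq> unit_disc"
    and a: "a \<in> unit_disc" and b: "b \<in> unit_disc"
  shows "cmod (F a - F b) * cmod (1 - cnj a * b) \<le> cmod (a - b) * cmod (1 - cnj (F a) * F b)"
proof -
  have nz: "1 - cnj u * v \<noteq> 0" if "cmod u < 1" "cmod v < 1" for u v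
  proof
    assume "1 - cnj u * v = 0"
    then have "cmod u * cmod v = 1"
      by (metis complex_mod_cnj eq_iff_diff_eq_0 norm_mult norm_one)
    moreover have "cmod u * cmod v \<le> cmod u" using that by (simp add: mult_left_le)
    ultimately show False using that by linarith
  qed
  have Fin: "cmod (F z) < 1" if "cmod z < 1" for z using F(2) that by force
  have a1: "cmod a < 1" and b1: "cmod b < 1" using a b by auto
  define G where "G = Moebius_function 0 (F a) \<circ> (F \<circ> Moebius_function 0 (- a))"
  define \<xi> where "\<xi> = Moebius_function 0 a b"
  have \<xi>1: "cmod \<xi> < 1" unfolding \<xi>_def using a1 b1 by (simp add: Moebius_function_norm_lt_1)
  have inverse_eq: "Moebius_function 0 (- a) \<xi> = b"
    unfolding \<xi>_def using a1 b1 by (intro Moebius_function_compose) auto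
  have G0: "G 0 = 0"
    by (simp add: G_def Moebius_function_of_zero Moebius_function_eq_zero)
  have holM: "Moebius_function 0 (- a) holomorphic_on unit_disc"
    using a1 by (intro Moebius_function_holomorphic) auto
  have holG: "G holomorphic_on unit_disc"
    unfolding G_def
  proof (intro holomorphic_on_compose_gen)
    show "Moebius_function 0 (- a) holomorphic_on unit_disc" by (fact holM)
    show "F holomorphic_on unit_disc" by (fact F(1))
    show "Moebius_function 0 (F a) holomorphic_on unit_disc"
      using Fin a1 by (intro Moebius_function_holomorphic) auto
    show "Moebius_function 0 (- a) ` unit_disc \<subseteq> unit_disc"
      using a1 by (auto simp: Moebius_function_norm_lt_1)
    show "(F \<circ> Moebius_function 0 (- a)) ` unit_disc \<subseteq> unit_disc"
      using a1 Fin by (auto simp: Moebius_function_norm_lt_1)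
  qed
  have Gn: "cmod (G z) < 1" if "cmod z < 1" for z
    using that a1 Fin by (simp add: G_def Moebius_function_norm_lt_1)
  have "cmod (G \<xi>) \<le> cmod \<xi>"
    using Schwarz_Lemma(1)[OF holG G0 Gn \<xi>1] .
  then have "cmod (F b - F a) / cmod (1 - cnj (F a) * F b) \<le> cmod (b - a) / cmod (1 - cnj a * b)"
    using inverse_eq by (simp add: G_def \<xi>_def Moebius_function_simple norm_divide)
  moreover have "cmod (1 - cnj (F a) * F b) > 0" "cmod (1 - cnj a * b) > 0"
    using nz a1 b1 Fin by auto
  ultimately show ?thesis
    by (simp add: field_simps norm_minus_commute)
qed

text \<open>A hyperbolic ball about a point \<open>A\<close> of the disc is a Euclidean region whose size is comparable
  to the distance of \<open>A\<close> to the circle. Since holomorphic self-maps do not increase hyperbolic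
  distance, one constant serves all self-maps \<open>F\<close> at once, in particular all iterates of a
  given map; this uniformity is what makes the estimate useful for dynamics.\<close>

lemma orbit_comparison:
  assumes a: "a \<in> unit_disc" and L: "compact L" "L \<subseteq> unit_disc"
  obtains M where "M > 0"
    "\<And>F b. F holomorphic_on unit_disc \<Longrightarrow> F ` unit_disc \<subseteq> unit_disc \<Longrightarrow> b \<in> L \<Longrightarrow>
       cmod (F a - F b) \<le> M * (1 - cmod (F a)) \<and> cmod (F a - F b) \<le> M * (1 - cmod (F b))"
proof -
  obtain s where s: "0 \<le> s" "s < 1" "\<And>b. b \<in> L \<Longrightarrow> cmod b \<le> s"
  proof (cases "L = {}")
    case True
    then show ?thesis using that[of 0] by auto
  next
    case False
    then obtain m where "m \<in> L" "\<And>b. b \<in> L \<Longrightarrow> cmod b \<le> cmod m"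
      using continuous_attains_sup[OF L(1), of cmod] continuous_on_norm_id by blast
    then show ?thesis using that[of "cmod m"] L(2) by auto
  qed
  \<comment> \<open>A lower bound on \<open>L\<close> for one minus the squared pseudo-hyperbolic distance to \<open>a\<close>,
    the denominator being at most \<open>2\<^sup>2\<close>.\<close>
  define c where "c = (1 - (cmod a)\<^sup>2) * (1 - s\<^sup>2) / 4"
  have a1: "cmod a < 1" using a by simp
  have c0: "c > 0" unfolding c_def using a1 s
    by (simp add: power_less_one_iff abs_square_less_1)
  show ?thesis
  proof
    show "4 / c > 0" using c0 by simp
    fix F b assume F: "F holomorphic_on unit_disc" "F ` unit_disc \<subseteq> unit_disc" and b: "b \<in> L"
    have b1: "cmod b < 1" using L b by auto
    define A B where "A = F a" and "B = F b"
    have A1: "cmod A < 1" and B1: "cmod B < 1"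
      using F(2) a1 b1 by (force simp: A_def B_def)+
    have sp: "cmod (A - B) * cmod (1 - cnj a * b) \<le> cmod (a - b) * cmod (1 - cnj A * B)"
      unfolding A_def B_def using schwarz_pick[OF F] a1 b1 by auto
    define x where "x = cmod (1 - cnj A * B)"
    define y where "y = cmod (1 - cnj a * b)"
    have y2: "y \<le> 2"
    proof -
      have "y \<le> 1 + cmod a * cmod b"
        unfolding y_def by (metis complex_mod_cnj norm_mult norm_one norm_triangle_ineq4)
      also have "\<dots> \<le> 1 + 1" using a1 b1 by (intro add_left_mono) (simp add: mult_le_one)
      finally show ?thesis by simp
    qed
    have x0: "x \<ge> 0" "y \<ge> 0" by (auto simp: x_def y_def)
    have y0: "y > 0"
    proof -
      have "cmod (cnj a * b) \<le> cmod a" using a1 b1 by (simp add: norm_mult mult_left_le)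
      then have "cnj a * b \<noteq> 1" using a1 by auto
      then show ?thesis by (simp add: y_def)
    qed
    have "(cmod (A - B))\<^sup>2 * y\<^sup>2 \<le> (cmod (a - b))\<^sup>2 * x\<^sup>2"
      using power_mono[OF sp, of 2] by (simp add: power_mult_distrib x_def y_def)
    then have "(x\<^sup>2 - (cmod (A - B))\<^sup>2) * y\<^sup>2 \<ge> x\<^sup>2 * (y\<^sup>2 - (cmod (a - b))\<^sup>2)"
      by (simp add: algebra_simps)
    then have "(1 - (cmod A)\<^sup>2) * (1 - (cmod B)\<^sup>2) * y\<^sup>2 \<ge> x\<^sup>2 * ((1 - (cmod a)\<^sup>2) * (1 - (cmod b)\<^sup>2))"
      unfolding x_def y_def disc_norm_identity .
    moreover have "(1 - (cmod a)\<^sup>2) * (1 - (cmod b)\<^sup>2) \<ge> c * y\<^sup>2"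
    proof -
      have "y\<^sup>2 \<le> 2\<^sup>2" using y2 x0 by (intro power_mono) auto
      then have "c * y\<^sup>2 \<le> c * 4" using c0 by simp
      also have "\<dots> = (1 - (cmod a)\<^sup>2) * (1 - s\<^sup>2)" by (simp add: c_def)
      also have "\<dots> \<le> (1 - (cmod a)\<^sup>2) * (1 - (cmod b)\<^sup>2)"
        using s b a1 by (intro mult_left_mono diff_left_mono power_mono)
          (auto simp: abs_square_le_1)
      finally show ?thesis .
    qed
    ultimately have prod: "(1 - (cmod A)\<^sup>2) * (1 - (cmod B)\<^sup>2) * y\<^sup>2 \<ge> x\<^sup>2 * (c * y\<^sup>2)"
      by (meson mult_left_mono order_trans zero_le_power2)
    \<comment> \<open>The bound \<open>c\<close> is inherited by the images, which are hyperbolically no farther apart.\<close>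
    have key: "(1 - (cmod A)\<^sup>2) * (1 - (cmod B)\<^sup>2) \<ge> c * x\<^sup>2"
    proof (rule mult_right_le_imp_le)
      show "c * x\<^sup>2 * y\<^sup>2 \<le> (1 - (cmod A)\<^sup>2) * (1 - (cmod B)\<^sup>2) * y\<^sup>2"
        using prod by (simp only: mult_ac)
      show "0 < y\<^sup>2" using y0 by simp
    qed
    have ABx: "cmod (A - B) \<le> x"
    proof -
      have "(cmod (A - B))\<^sup>2 \<le> x\<^sup>2"
      proof -
        have "0 \<le> (1 - (cmod A)\<^sup>2) * (1 - (cmod B)\<^sup>2)"
          using A1 B1 by (simp add: abs_square_le_1 less_imp_le)
        then show ?thesis using disc_norm_identity[of A B] unfolding x_def by linarith
      qed
      then show ?thesis using x0 power2_le_imp_le by blast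
    qed
    have prodle: "cmod A * cmod B \<le> cmod A" "cmod A * cmod B \<le> cmod B"
      using A1 B1 by (auto simp: mult_left_le mult_left_le_one_le)
    have "1 - cmod A * cmod B \<le> x"
      unfolding x_def by (metis complex_mod_cnj norm_mult norm_one norm_triangle_ineq2)
    then have xA: "1 - cmod A \<le> x" and xB: "1 - cmod B \<le> x"
      using prodle by linarith+
    have x0': "x > 0" using xA A1 by linarith
    have sq: "1 - u\<^sup>2 \<le> 2 * (1 - u)" for u :: real
      using zero_le_power2[of "1 - u"] by (simp add: power2_eq_square algebra_simps)
    have bound: "c * x \<le> 4 * (1 - u)"
      if "(1 - u\<^sup>2) * (1 - v\<^sup>2) \<ge> c * x\<^sup>2" "1 - v \<le> x" "0 \<le> u" "u < 1" "0 \<le> v" "v < 1" for u v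
    proof -
      have "c * x\<^sup>2 \<le> (2 * (1 - u)) * (2 * x)"
      proof -
        have "(1 - u\<^sup>2) * (1 - v\<^sup>2) \<le> (2 * (1 - u)) * (2 * x)"
          using that sq[of u] sq[of v]
          by (intro mult_mono) (auto simp: abs_square_le_1)
        then show ?thesis using that by linarith
      qed
      then have "(c * x) * x \<le> (4 * (1 - u)) * x" by (simp add: power2_eq_square algebra_simps)
      then show ?thesis using x0' by simp
    qed
    have "c * x \<le> 4 * (1 - cmod A)" using bound[OF key xB] A1 B1 by simp
    moreover have "c * x \<le> 4 * (1 - cmod B)"
      using bound[of "cmod B" "cmod A"] key xA A1 B1 by (simp add: mult.commute)
    ultimately
    show "cmod (F a - F b) \<le> 4 / c * (1 - cmod (F a)) \<and> cmod (F a - F b) \<le> 4 / c * (1 - cmod (F b))"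
    proof -
      have "cmod (A - B) \<le> 4 / c * (1 - u)" if "c * x \<le> 4 * (1 - u)" for u
      proof -
        have "c * cmod (A - B) \<le> c * x" using ABx c0 by simp
        then have "c * cmod (A - B) \<le> 4 * (1 - u)" using that by linarith
        then show ?thesis using c0 by (simp add: field_simps)
      qed
      then show ?thesis
        using \<open>c * x \<le> 4 * (1 - cmod A)\<close> \<open>c * x \<le> 4 * (1 - cmod B)\<close>
        unfolding A_def[symmetric] B_def[symmetric] by blast
    qed
  qed
qed

section \<open>Holomorphic maps commuting with a translation\<close>

text \<open>Deep inside a half-plane the translation by 1 is a small motion in the hyperbolic metric, while
  in a strip it moves every point by at least a fixed amount, so that the Schwarz--Pick principle forbids
  such a map. Explicitly, if the imaginary part of \<open>\<psi>\<close> is bounded, then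
  \<open>exp (\<i> \<psi>)\<close> is bounded above and below, and the Cauchy estimate on a large ball makes the
  derivative of \<open>\<psi>\<close> small at the centre, too small for \<open>\<psi>\<close> to advance by 1 along a segment
  of length 1.\<close>

lemma large_balls_not_into_strip:
  assumes hol: "\<psi> holomorphic_on S" and transl: "\<And>w. w \<in> S \<Longrightarrow> w + 1 \<in> S \<Longrightarrow> \<psi> (w + 1) = \<psi> w + 1"
    and big: "\<And>R. \<exists>w. ball w R \<subseteq> S" and im: "\<And>w. w \<in> S \<Longrightarrow> c < Im (\<psi> w) \<and> Im (\<psi> w) < d"
  shows False
proof -
  define F where "F w = exp (\<i> * \<psi> w)" for w
  have nF: "cmod (F w) = exp (- Im (\<psi> w))" for w by (simp add: F_def)
  define K where "K = exp (- c) * exp d"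
  have K0: "K > 0" by (simp add: K_def)
  \<comment> \<open>Each point of the unit disc about \<open>w0\<close> is the centre of a disc of radius \<open>2 * K\<close> in \<open>S\<close>,
    on which the Cauchy estimate bounds the derivative of \<open>\<psi>\<close> by \<open>K / (2 * K)\<close>.\<close>
  obtain w0 where w0: "ball w0 (2 * K + 3) \<subseteq> S" using big by blast
  have der: "cmod (deriv \<psi> w) \<le> 1 / 2" if w: "w \<in> cball w0 1" for w
  proof -
    define R where "R = 2 * K"
    have sub: "cball w R \<subseteq> ball w0 (2 * K + 3)"
      using w by (auto simp: R_def dist_norm) (smt (verit) dist_norm dist_triangle)
    have sub': "cball w R \<subseteq> S" using sub w0 by blast
    have wS: "w \<in> ball w0 (2 * K + 3)" using w K0 by auto
    have holF: "F holomorphic_on ball w0 (2 * K + 3)"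
      unfolding F_def using holomorphic_on_subset[OF hol w0] by (intro holomorphic_intros)
    have "cmod ((deriv ^^ 1) F w) \<le> fact 1 * exp (- c) / R ^ 1"
    proof (rule Cauchy_inequality)
      show "F holomorphic_on ball w R" using holF sub by (meson ball_subset_cball holomorphic_on_subset)
      show "continuous_on (cball w R) F"
        using holF sub by (meson holomorphic_on_imp_continuous_on holomorphic_on_subset)
      show "R > 0" using K0 by (simp add: R_def)
      show "cmod (F x) \<le> exp (- c)" if "cmod (w - x) = R" for x
      proof -
        have "x \<in> S" using sub' that by (auto simp: dist_norm)
        then show ?thesis using im[of x] by (simp add: nF)
      qed
    qed
    then have b1: "cmod (deriv F w) \<le> exp (- c) / R" by simp
    have d\<psi>: "(\<psi> has_field_derivative deriv \<psi> w) (at w)"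
      using holomorphic_derivI[OF holomorphic_on_subset[OF hol w0] open_ball wS] .
    have "(F has_field_derivative F w * (\<i> * deriv \<psi> w)) (at w)"
      unfolding F_def by (rule derivative_eq_intros d\<psi> refl | simp)+
    then have "deriv F w = F w * (\<i> * deriv \<psi> w)" by (rule DERIV_imp_deriv)
    then have "cmod (deriv F w) = exp (- Im (\<psi> w)) * cmod (deriv \<psi> w)"
      by (simp add: norm_mult nF)
    moreover have "exp (- d) * cmod (deriv \<psi> w) \<le> exp (- Im (\<psi> w)) * cmod (deriv \<psi> w)"
      using im[of w] wS w0 by (intro mult_right_mono) (auto simp: less_imp_le subset_iff)
    ultimately have "exp (- d) * cmod (deriv \<psi> w) \<le> exp (- c) / R" using b1 by linarith
    then have "exp d * (exp (- d) * cmod (deriv \<psi> w)) \<le> exp d * (exp (- c) / R)"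
      by (intro mult_left_mono) auto
    then have "cmod (deriv \<psi> w) \<le> K / R"
      by (simp add: K_def mult.assoc[symmetric] exp_add[symmetric] mult.commute)
    then show ?thesis using K0 by (simp add: R_def)
  qed
  have inb: "cball w0 1 \<subseteq> ball w0 (2 * K + 3)" using K0 by auto
  have "cmod (\<psi> (w0 + 1) - \<psi> w0) \<le> 1 / 2 * cmod (w0 + 1 - w0)"
  proof (rule field_differentiable_bound)
    show "convex (cball w0 1)" by simp
    show "(\<psi> has_field_derivative deriv \<psi> z) (at z within cball w0 1)" if "z \<in> cball w0 1" for z
      using holomorphic_derivI[OF holomorphic_on_subset[OF hol w0] open_ball] that inb
      by (meson has_field_derivative_at_within subsetD)
  qed (use der in \<open>auto simp: dist_norm\<close>)
  moreover have "\<psi> (w0 + 1) = \<psi> w0 + 1"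
  proof (rule transl)
    have "w0 \<in> cball w0 1" "w0 + 1 \<in> cball w0 1" by (auto simp: dist_norm)
    then show "w0 \<in> S" "w0 + 1 \<in> S" using inb w0 by blast+
  qed
  ultimately show False by simp
qed

text \<open>By Liouville's theorem \<open>exp (\<plusminus>\<i> \<psi>)\<close> is constant, hence so is \<open>\<psi>\<close>, which cannot advance by 1.\<close>

lemma plane_not_into_half_plane:
  assumes hol: "\<psi> holomorphic_on UNIV" and transl: "\<psi> (w + 1) = \<psi> w + 1"
    and im: "(\<forall>w. c < Im (\<psi> w)) \<or> (\<forall>w. Im (\<psi> w) < c)"
  shows False
proof -
  have *: False if hol: "\<psi> holomorphic_on UNIV" and transl: "\<psi> (w + 1) = \<psi> w + s" "s \<noteq> 0"
    and im: "\<forall>w. c < Im (\<psi> w)" for \<psi> c s w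
  proof -
    define F where "F w = exp (\<i> * \<psi> w)" for w
    have holF: "F holomorphic_on UNIV"
      unfolding F_def using hol by (intro holomorphic_intros)
    have "bounded (range F)"
      unfolding bounded_iff F_def using im
      by (intro exI[of _ "exp (- c)"]) (auto simp: less_imp_le)
    then have "F constant_on UNIV" using Liouville_theorem[OF holF] by blast
    then obtain k where k: "\<And>w. F w = k" by (auto simp: constant_on_def)
    have "\<psi> constant_on UNIV"
    proof (rule has_field_derivative_0_imp_constant_on)
      fix w
      have d: "(\<psi> has_field_derivative deriv \<psi> w) (at w)"
        using holomorphic_derivI[OF hol] by auto
      have "(F has_field_derivative F w * (\<i> * deriv \<psi> w)) (at w)"
        unfolding F_def by (rule derivative_eq_intros d refl | simp)+
      moreover have "(F has_field_derivative 0) (at w)"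
        using k by (metis DERIV_const ext)
      ultimately have "F w * (\<i> * deriv \<psi> w) = 0" using DERIV_unique by blast
      then have "deriv \<psi> w = 0" by (simp add: F_def)
      then show "(\<psi> has_field_derivative 0) (at w)" using d by simp
    qed auto
    then show False using transl by (auto simp: constant_on_def)
  qed
  show False
    using im
  proof
    assume "\<forall>w. c < Im (\<psi> w)"
    then show False using *[OF hol transl] by simp
  next
    assume im: "\<forall>w. Im (\<psi> w) < c"
    have "(\<lambda>w. - \<psi> w) holomorphic_on UNIV" using hol by (intro holomorphic_intros)
    then show False using *[of "\<lambda>w. - \<psi> w" w "-1" "- c"] im transl by simp
  qed
qed

lemma half_planes_contain_large_balls:
  fixes a :: real
  shows "\<exists>w. ball w R \<subseteq> {w. a < Im w}" "\<exists>w. ball w R \<subseteq> {w. Im w < a}"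
proof -
  have *: "\<bar>Im w - Im z\<bar> \<le> dist w z" for w z by (metis abs_Im_le_cmod dist_norm minus_complex.sel(2))
  show "\<exists>w. ball w R \<subseteq> {w. a < Im w}"
  proof (intro exI subsetI)
    fix z assume "z \<in> ball (Complex 0 (a + R)) R"
    then show "z \<in> {w. a < Im w}" using *[of "Complex 0 (a + R)" z] by auto
  qed
  show "\<exists>w. ball w R \<subseteq> {w. Im w < a}"
  proof (intro exI subsetI)
    fix z assume "z \<in> ball (Complex 0 (a - R)) R"
    then show "z \<in> {w. Im w < a}" using *[of "Complex 0 (a - R)" z] by auto
  qed
qed

lemma open_connected_real_cases:
  fixes J :: "real set"
  assumes J: "open J" "connected J" "J \<noteq> {}"
  obtains "J = UNIV" | b where "J = {..<b}" | a where "J = {a<..}"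
    | a b where "a < b" "J = {a<..<b}"
proof -
  have ivl: "x \<in> J" if "a \<in> J" "b \<in> J" "a \<le> x" "x \<le> b" for a b x
    using J(2) that by (meson connected_contains_Icc atLeastAtMost_iff subsetD)
  have inner: "(\<exists>y\<in>J. y < x) \<and> (\<exists>y\<in>J. x < y)" if x: "x \<in> J" for x
  proof -
    obtain e where e: "e > 0" "cball x e \<subseteq> J" using J(1) x open_contains_cball by blast
    then have "x - e \<in> J" "x + e \<in> J" by (auto simp: subset_iff dist_real_def)
    then show ?thesis using e(1) by (intro conjI bexI[of _ "x - e"] bexI[of _ "x + e"]) auto
  qed
  have "\<exists>a b. J = {} \<or> J = UNIV \<or> J = {..<b} \<or> J = {..b} \<or> J = {a<..} \<or> J = {a..} \<or>
      J = {a<..<b} \<or> J = {a<..b} \<or> J = {a..<b} \<or> J = {a..b}"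
    by (rule interval_cases) (rule ivl)
  then obtain a b where ab: "J = {} \<or> J = UNIV \<or> J = {..<b} \<or> J = {..b} \<or> J = {a<..} \<or>
      J = {a..} \<or> J = {a<..<b} \<or> J = {a<..b} \<or> J = {a..<b} \<or> J = {a..b}"
    by blast
  have "J \<noteq> {..b}" "J \<noteq> {a..}" "J \<noteq> {a<..b}" "J \<noteq> {a..<b}" "J \<noteq> {a..b}"
    using inner[of a] inner[of b] J(3) by force+
  moreover have "a < b" if "J = {a<..<b}" using that J(3) by auto
  ultimately show thesis using ab J(3) that by blast
qed

text \<open>Such a set is a union of horizontal lines, so it is determined by the open interval of heights
  that it meets.\<close>

lemma horizontally_saturated_cases:
  assumes S: "open S" "connected S" "S \<noteq> {}"
    and sat: "\<And>w t. w \<in> S \<Longrightarrow> w + complex_of_real t \<in> S"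
  shows "S = UNIV \<or> horizontal_strip S \<or> horizontal_half_plane S"
proof -
  define J where "J = (\<lambda>y. \<i> * complex_of_real y) -` S"
  have SJ: "w \<in> S \<longleftrightarrow> Im w \<in> J" for w
  proof -
    have "\<i> * complex_of_real (Im w) = w + complex_of_real (- Re w)"
      "w = \<i> * complex_of_real (Im w) + complex_of_real (Re w)"
      by (simp_all add: complex_eq_iff)
    then show ?thesis unfolding J_def using sat by (metis vimage_eq)
  qed
  have imS: "J = Im ` S"
  proof
    show "J \<subseteq> Im ` S"
    proof
      fix y assume "y \<in> J"
      then have "\<i> * complex_of_real y \<in> S" by (simp add: J_def)
      then show "y \<in> Im ` S" by (intro image_eqI[of _ _ "\<i> * complex_of_real y"]) auto
    qed
  qed (use SJ in auto)
  have "open J" unfolding J_def using S(1) by (intro open_vimage continuous_intros)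
  moreover have "connected J"
    unfolding imS by (intro connected_continuous_image S continuous_intros)
  moreover have "J \<noteq> {}" using S(3) imS by simp
  ultimately show ?thesis
  proof (cases rule: open_connected_real_cases)
    case 1
    then have "S = UNIV" using SJ by auto
    then show ?thesis by blast
  next
    case (2 b)
    then have "S = {w. Im w < b}" using SJ by auto
    then show ?thesis unfolding horizontal_half_plane_def by blast
  next
    case (3 a)
    then have "S = {w. a < Im w}" using SJ by auto
    then show ?thesis unfolding horizontal_half_plane_def by blast
  next
    case (4 a b)
    then have "S = {w. a < Im w \<and> Im w < b}" using SJ by auto
    then show ?thesis unfolding horizontal_strip_def using 4 by blast
  qed
qed

section \<open>The type of a non-elliptic map\<close>

lemma mem_discrete_hull: "w \<in> discrete_hull \<Omega> \<longleftrightarrow> (\<exists>n\<ge>1. w + of_nat n \<in> \<Omega>)"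
proof -
  have "w \<in> (\<lambda>w. w - of_nat n) ` \<Omega> \<longleftrightarrow> w + of_nat n \<in> \<Omega>" for n
    by (force simp: image_iff)
  then show ?thesis unfolding discrete_hull_def by auto
qed

text \<open>Moving right is part of starlikeness; moving left by an integer is built into the hull, and
  every left translation is an integer one followed by a translation to the right.\<close>

lemma discrete_hull_saturated:
  assumes S: "starlike_at_infinity (discrete_hull \<Omega>)" and w: "w \<in> discrete_hull \<Omega>"
  shows "w + complex_of_real t \<in> discrete_hull \<Omega>"
proof -
  obtain n where n: "real n \<ge> - t" using real_arch_simple by blast
  obtain m where m: "m \<ge> 1" "w + of_nat m \<in> \<Omega>" using w by (auto simp: mem_discrete_hull)
  have "w - of_nat n \<in> discrete_hull \<Omega>"
    unfolding mem_discrete_hull using m by (intro exI[of _ "n + m"]) (simp add: algebra_simps)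
  moreover have "t + real n \<ge> 0" using n by linarith
  ultimately have "w - of_nat n + complex_of_real (t + real n) \<in> discrete_hull \<Omega>"
    using S unfolding starlike_at_infinity_def by blast
  then show ?thesis by (simp add: algebra_simps)
qed

lemma iterate_in_disc:
  assumes "f ` unit_disc \<subseteq> unit_disc" "z \<in> unit_disc"
  shows "(f ^^ n) z \<in> unit_disc"
  using assms by (induction n) (auto simp: image_subset_iff)

lemma koenigs_iterate:
  assumes "f ` unit_disc \<subseteq> unit_disc" "koenigs_pair f h \<Omega>" "z \<in> unit_disc"
  shows "h ((f ^^ n) z) = h z + of_nat n"
proof (induction n)
  case (Suc n)
  have "h (f ((f ^^ n) z)) = h ((f ^^ n) z) + 1"
    using assms(2) iterate_in_disc[OF assms(1,3)] unfolding koenigs_pair_def by blast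
  then show ?case using Suc by simp
qed simp

lemma fundamental_domain_absorbs:
  assumes "fundamental_domain f U" "z \<in> unit_disc"
  obtains N where "\<And>n. n \<ge> N \<Longrightarrow> (f ^^ n) z \<in> U"
proof -
  have "z \<in> (\<Union>n\<in>{1::nat..}. {z \<in> unit_disc. (f ^^ n) z \<in> U})"
    using assms unfolding fundamental_domain_def by blast
  then obtain N where N: "(f ^^ N) z \<in> U" by blast
  have fU: "f ` U \<subseteq> U" using assms unfolding fundamental_domain_def by blast
  have "(f ^^ (k + N)) z \<in> U" for k
    using N fU by (induction k) (auto simp: image_subset_iff)
  then have "(f ^^ n) z \<in> U" if "n \<ge> N" for n
    using that by (metis le_add_diff_inverse2)
  then show ?thesis using that by blast
qed

text \<open>The hull of \<open>\<Omega>\<close> is the abstract basin in which \<open>f\<close> becomes the automorphism \<open>w \<mapsto> w + 1\<close>,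
  and \<open>w = h z - n\<close> stands for ``the point that reaches \<open>z\<close> after \<open>n\<close> steps''. Sending it to
  \<open>h' z - n\<close> is well defined: two representatives have iterates with equal \<open>h\<close>-value in a
  fundamental domain on which \<open>h\<close> is injective, hence equal iterates. Locally the map is \<open>h'\<close>
  composed with an inverse branch of \<open>h\<close>, up to integer translations, which gives holomorphy.\<close>

lemma koenigs_pairs_comparison:
  assumes f: "f ` unit_disc \<subseteq> unit_disc"
    and K: "koenigs_pair f h \<Omega>" and K': "koenigs_pair f h' \<Omega>'"
  obtains \<psi> where "\<psi> holomorphic_on discrete_hull \<Omega>"
    "\<psi> ` discrete_hull \<Omega> \<subseteq> discrete_hull \<Omega>'"
    "\<And>w. w \<in> discrete_hull \<Omega> \<Longrightarrow> \<psi> (w + 1) = \<psi> w + 1"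
proof -
  obtain U where U: "fundamental_domain f U" "univalent_on h U"
    using K unfolding koenigs_pair_def by blast
  have Usub: "U \<subseteq> unit_disc" and openU: "open U"
    using U(1) unfolding fundamental_domain_def is_domain_def by auto
  have h\<Omega>: "h ` unit_disc = \<Omega>" "h' ` unit_disc = \<Omega>'" and hol': "h' holomorphic_on unit_disc"
    using K K' unfolding koenigs_pair_def by auto
  have wd: "h' z - of_nat n = h' z' - of_nat m"
    if z: "z \<in> unit_disc" "z' \<in> unit_disc" and eq: "h z - of_nat n = h z' - of_nat m"
    for z z' and n m :: nat
  proof -
    obtain N1 where N1: "\<And>k. k \<ge> N1 \<Longrightarrow> (f ^^ k) z \<in> U"
      using fundamental_domain_absorbs[OF U(1) z(1)] by blast
    obtain N2 where N2: "\<And>k. k \<ge> N2 \<Longrightarrow> (f ^^ k) z' \<in> U"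
      using fundamental_domain_absorbs[OF U(1) z(2)] by blast
    define N where "N = N1 + N2"
    have "h ((f ^^ (N + m)) z) = h ((f ^^ (N + n)) z')"
      using eq koenigs_iterate[OF f K z(1), of "N + m"] koenigs_iterate[OF f K z(2), of "N + n"]
      by (simp add: algebra_simps)
    moreover have "(f ^^ (N + m)) z \<in> U" "(f ^^ (N + n)) z' \<in> U"
      using N1 N2 by (auto simp: N_def)
    ultimately have "(f ^^ (N + m)) z = (f ^^ (N + n)) z'"
      using U(2) unfolding univalent_on_def by (meson inj_onD)
    then have "h' z + of_nat (N + m) = h' z' + of_nat (N + n)"
      by (metis koenigs_iterate[OF f K'] z)
    then show ?thesis by (simp add: algebra_simps)
  qed
  define \<psi> where "\<psi> w = (SOME v. \<exists>z n. z \<in> unit_disc \<and> n \<ge> (1::nat) \<and> h z = w + of_nat n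
      \<and> v = h' z - of_nat n)" for w
  have \<psi>: "\<psi> w = h' z - of_nat n" if "z \<in> unit_disc" "n \<ge> 1" "h z = w + of_nat n" for w z n
    unfolding \<psi>_def
  proof (rule some_equality)
    show "\<exists>z' n'. z' \<in> unit_disc \<and> n' \<ge> (1::nat) \<and> h z' = w + of_nat n'
        \<and> h' z - of_nat n = h' z' - of_nat n'"
      using that by blast
  next
    fix v assume "\<exists>z n. z \<in> unit_disc \<and> n \<ge> (1::nat) \<and> h z = w + of_nat n \<and> v = h' z - of_nat n"
    then obtain z' n' where v: "z' \<in> unit_disc" "h z' = w + of_nat n'" "v = h' z' - of_nat n'"
      by blast
    then show "v = h' z - of_nat n" using wd[of z z' n n'] that by simp
  qed
  have rep: "\<exists>z n. z \<in> U \<and> n \<ge> (1::nat) \<and> h z = w + of_nat n" if w: "w \<in> discrete_hull \<Omega>" for w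
  proof -
    obtain n z where n: "n \<ge> 1" "z \<in> unit_disc" "h z = w + of_nat n"
      using w h\<Omega>(1) unfolding mem_discrete_hull by (metis imageE)
    obtain N where N: "\<And>k. k \<ge> N \<Longrightarrow> (f ^^ k) z \<in> U"
      using fundamental_domain_absorbs[OF U(1) n(2)] by blast
    have "h ((f ^^ N) z) = w + of_nat (n + N)"
      using n by (simp add: koenigs_iterate[OF f K] algebra_simps)
    moreover have "(f ^^ N) z \<in> U" "n + N \<ge> 1" using N n by auto
    ultimately show ?thesis by blast
  qed
  obtain k where k: "k holomorphic_on (h ` U)" "\<And>z. z \<in> U \<Longrightarrow> k (h z) = z"
    using holomorphic_has_inverse[OF _ openU] U(2) unfolding univalent_on_def by metis
  have openhU: "open (h ` U)"
    using open_mapping_thm3 openU U(2) unfolding univalent_on_def by blast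
  have "\<psi> holomorphic_on discrete_hull \<Omega>"
    unfolding holomorphic_on_def
  proof
    fix w assume "w \<in> discrete_hull \<Omega>"
    then obtain z n where z: "z \<in> U" "n \<ge> (1::nat)" "h z = w + of_nat n" using rep by blast
    define T where "T = (\<lambda>v. v - of_nat n) ` (h ` U)"
    have T: "open T" "w \<in> T"
      using z open_translation_subtract[OF openhU] by (auto simp: T_def image_iff intro!: bexI[of _ z])
    have shift: "(\<lambda>v. v + of_nat n) ` T \<subseteq> h ` U" by (auto simp: T_def)
    have kU: "k ` h ` U \<subseteq> unit_disc" using k(2) Usub by auto
    have comp: "(h' \<circ> (k \<circ> (\<lambda>v. v + of_nat n))) holomorphic_on T"
    proof (rule holomorphic_on_compose_gen)
      show "(k \<circ> (\<lambda>v. v + of_nat n)) holomorphic_on T"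
        by (rule holomorphic_on_compose_gen[OF _ k(1) shift]) (intro holomorphic_intros)
      show "(k \<circ> (\<lambda>v. v + of_nat n)) ` T \<subseteq> unit_disc"
        using shift kU by (auto simp: image_subset_iff)
    qed (fact hol')
    have "(\<lambda>v. (h' \<circ> (k \<circ> (\<lambda>v. v + of_nat n))) v - of_nat n) holomorphic_on T"
      using comp by (rule holomorphic_on_diff) (rule holomorphic_on_const)
    moreover have "(h' \<circ> (k \<circ> (\<lambda>v. v + of_nat n))) v - of_nat n = \<psi> v" if vT: "v \<in> T" for v
    proof -
      obtain u where u: "u \<in> U" "v = h u - of_nat n" using vT unfolding T_def by blast
      have "\<psi> v = h' u - of_nat n" using u Usub z by (intro \<psi>) auto
      then show ?thesis using u k(2) by simp
    qed
    ultimately have "\<psi> holomorphic_on T" by (rule holomorphic_transform)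
    then show "\<psi> field_differentiable at w within discrete_hull \<Omega>"
      using T by (meson field_differentiable_at_within holomorphic_on_imp_differentiable_at)
  qed
  moreover have "\<psi> ` discrete_hull \<Omega> \<subseteq> discrete_hull \<Omega>'"
  proof
    fix v assume "v \<in> \<psi> ` discrete_hull \<Omega>"
    then obtain w where w: "w \<in> discrete_hull \<Omega>" "v = \<psi> w" by blast
    then obtain z n where z: "z \<in> U" "n \<ge> (1::nat)" "h z = w + of_nat n" using rep by blast
    then have "v = h' z - of_nat n" using \<psi>[of z n w] w Usub by auto
    then have "v + of_nat n \<in> \<Omega>'" using h\<Omega> z Usub by auto
    then show "v \<in> discrete_hull \<Omega>'" using z mem_discrete_hull by blast
  qed
  moreover have "\<psi> (w + 1) = \<psi> w + 1" if w: "w \<in> discrete_hull \<Omega>" for w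
  proof -
    obtain z n where z: "z \<in> U" "n \<ge> (1::nat)" "h z = w + of_nat n" using rep w by blast
    have fz: "f z \<in> unit_disc" "h (f z) = (w + 1) + of_nat n" "h' (f z) = h' z + 1"
    proof -
      have zd: "z \<in> unit_disc" using z Usub by blast
      then show "f z \<in> unit_disc" using f by blast
      show "h (f z) = (w + 1) + of_nat n" "h' (f z) = h' z + 1"
        using z koenigs_iterate[OF f K zd, of 1] koenigs_iterate[OF f K' zd, of 1] by auto
    qed
    have "\<psi> (w + 1) = h' (f z) - of_nat n" using \<psi>[OF fz(1) z(2) fz(2)] .
    moreover have "\<psi> w = h' z - of_nat n" using \<psi>[of z n w] z Usub by auto
    ultimately show ?thesis using fz by simp
  qed
  ultimately show ?thesis using that by blast
qed

lemma strip_half_plane_exclusive: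
  "\<not> (horizontal_strip S \<and> horizontal_half_plane S)" "\<not> horizontal_strip UNIV"
  "\<not> horizontal_half_plane UNIV"
proof -
  have U: "\<not> horizontal_half_plane UNIV"
  proof
    assume "horizontal_half_plane UNIV"
    then obtain a where "UNIV = {w. a < Im w} \<or> UNIV = {w. Im w < a}"
      unfolding horizontal_half_plane_def by blast
    then have "Complex 0 a \<in> {w. a < Im w} \<or> Complex 0 a \<in> {w. Im w < a}" by blast
    then show False by auto
  qed
  have *: "horizontal_strip S \<Longrightarrow> \<exists>c d. \<forall>w\<in>S. c < Im w \<and> Im w < d" for S
    unfolding horizontal_strip_def by blast
  have E: "\<not> (\<forall>w\<in>{w. a < Im w}. Im w < d)" for a d :: real
  proof
    assume "\<forall>w\<in>{w. a < Im w}. Im w < d"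
    then show False by (elim ballE[of _ _ "Complex 0 (max a d + 1)"]) auto
  qed
  have F: "\<not> (\<forall>w\<in>{w. Im w < a}. c < Im w)" for a c :: real
  proof
    assume "\<forall>w\<in>{w. Im w < a}. c < Im w"
    then show False by (elim ballE[of _ _ "Complex 0 (min a c - 1)"]) auto
  qed
  show "\<not> (horizontal_strip S \<and> horizontal_half_plane S)"
    using *[of S] E F unfolding horizontal_half_plane_def by metis
  show "\<not> horizontal_strip UNIV"
    using *[of UNIV] E by blast
  show "\<not> horizontal_half_plane UNIV" by (fact U)
qed

text \<open>The type of a map is defined through some Koenigs pair; this shows that it can be read off
  from any of them. The comparison maps exist in both directions, and the two obstructions
  above forbid every change of type: nothing larger maps to a strip, and the plane does not
  map to a half-plane.\<close>

lemma discrete_hull_type_unique: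
  assumes f: "f ` unit_disc \<subseteq> unit_disc"
    and K: "koenigs_pair f h \<Omega>" and K': "koenigs_pair f h' \<Omega>'"
  shows "horizontal_strip (discrete_hull \<Omega>') \<Longrightarrow> horizontal_strip (discrete_hull \<Omega>)"
    and "horizontal_half_plane (discrete_hull \<Omega>') \<Longrightarrow> horizontal_half_plane (discrete_hull \<Omega>)"
    and "discrete_hull \<Omega>' = UNIV \<Longrightarrow> discrete_hull \<Omega> = UNIV"
proof -
  have cases: "discrete_hull \<Omega> = UNIV \<or> horizontal_strip (discrete_hull \<Omega>) \<or>
      horizontal_half_plane (discrete_hull \<Omega>)" if "koenigs_pair f h \<Omega>" for h \<Omega>
  proof -
    have star: "starlike_at_infinity (discrete_hull \<Omega>)"
      using that unfolding koenigs_pair_def asymptotically_starlike_at_infinity_def by blast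
    then show ?thesis
      using horizontally_saturated_cases[of "discrete_hull \<Omega>"] discrete_hull_saturated[OF star]
      unfolding starlike_at_infinity_def is_domain_def by blast
  qed
  have not_into_strip: "horizontal_strip (discrete_hull \<Omega>)"
    if K: "koenigs_pair f h \<Omega>" and K': "koenigs_pair f h' \<Omega>'"
      and strip: "horizontal_strip (discrete_hull \<Omega>')" for h \<Omega> h' \<Omega>'
  proof (rule ccontr)
    assume "\<not> horizontal_strip (discrete_hull \<Omega>)"
    then have "discrete_hull \<Omega> = UNIV \<or> horizontal_half_plane (discrete_hull \<Omega>)"
      using cases[OF K] by blast
    then have big: "\<exists>w. ball w R \<subseteq> discrete_hull \<Omega>" for R
      unfolding horizontal_half_plane_def using half_planes_contain_large_balls by (metis top_greatest)
    obtain c d where cd: "\<And>w. w \<in> discrete_hull \<Omega>' \<Longrightarrow> c < Im w \<and> Im w < d"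
      using strip unfolding horizontal_strip_def by blast
    obtain \<psi> where \<psi>: "\<psi> holomorphic_on discrete_hull \<Omega>"
      "\<psi> ` discrete_hull \<Omega> \<subseteq> discrete_hull \<Omega>'"
      "\<And>w. w \<in> discrete_hull \<Omega> \<Longrightarrow> \<psi> (w + 1) = \<psi> w + 1"
      by (rule koenigs_pairs_comparison[OF f K K']) blast
    show False
    proof (rule large_balls_not_into_strip[OF \<psi>(1) \<psi>(3) big])
      show "c < Im (\<psi> w) \<and> Im (\<psi> w) < d" if "w \<in> discrete_hull \<Omega>" for w
        using cd \<psi>(2) that by blast
    qed
  qed
  have not_into_half_plane: "discrete_hull \<Omega> \<noteq> UNIV"
    if K: "koenigs_pair f h \<Omega>" and K': "koenigs_pair f h' \<Omega>'"
      and half: "horizontal_half_plane (discrete_hull \<Omega>')" for h \<Omega> h' \<Omega>'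
  proof
    assume U: "discrete_hull \<Omega> = UNIV"
    obtain \<psi> where \<psi>: "\<psi> holomorphic_on UNIV" "range \<psi> \<subseteq> discrete_hull \<Omega>'"
      "\<And>w. \<psi> (w + 1) = \<psi> w + 1"
      by (rule koenigs_pairs_comparison[OF f K K', unfolded U]) blast
    obtain c where "(\<forall>w. c < Im (\<psi> w)) \<or> (\<forall>w. Im (\<psi> w) < c)"
      using half \<psi>(2) unfolding horizontal_half_plane_def by blast
    then show False using plane_not_into_half_plane[OF \<psi>(1) \<psi>(3)] by blast
  qed
  show "horizontal_strip (discrete_hull \<Omega>') \<Longrightarrow> horizontal_strip (discrete_hull \<Omega>)"
    by (rule not_into_strip[OF K K'])
  show "horizontal_half_plane (discrete_hull \<Omega>') \<Longrightarrow> horizontal_half_plane (discrete_hull \<Omega>)"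
    using cases[OF K] not_into_half_plane[OF K K'] not_into_strip[OF K' K]
      strip_half_plane_exclusive by blast
  show "discrete_hull \<Omega>' = UNIV \<Longrightarrow> discrete_hull \<Omega> = UNIV"
    using cases[OF K] not_into_half_plane[OF K' K] not_into_strip[OF K' K]
      strip_half_plane_exclusive by metis
qed

section \<open>Uniqueness of the Koenigs function of a semigroup\<close>

text \<open>Differentiating the functional equation in \<open>t\<close> at \<open>0\<close> shows that the derivative of \<open>k\<close> is 1.\<close>

lemma commuting_with_translations:
  assumes W: "open W" "connected W" and k: "k holomorphic_on W"
    and transl: "\<And>w t. w \<in> W \<Longrightarrow> t \<ge> 0 \<Longrightarrow> k (w + complex_of_real t) = k w + complex_of_real t"
  obtains c where "\<And>w. w \<in> W \<Longrightarrow> k w = w + c"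
proof -
  have "(\<lambda>w. k w - w) constant_on W"
  proof (rule has_field_derivative_0_imp_constant_on)
    fix w assume w: "w \<in> W"
    have d: "(k has_field_derivative deriv k w) (at w)"
      using holomorphic_derivI[OF k W(1) w] .
    then have "((\<lambda>y. (k (w + y) - k w) / y) \<longlongrightarrow> deriv k w) (at 0)"
      by (simp add: DERIV_def)
    moreover have "filterlim complex_of_real (at 0) (at_right 0)"
    proof -
      have "(complex_of_real \<longlongrightarrow> 0) (at_right 0)"
        by (auto intro!: tendsto_eq_intros)
      then show ?thesis by (auto simp: filterlim_at eventually_at_filter)
    qed
    ultimately have "((\<lambda>t. (k (w + complex_of_real t) - k w) / complex_of_real t) \<longlongrightarrow> deriv k w) (at_right 0)"
      by (rule filterlim_compose)
    moreover have "\<forall>\<^sub>F t in at_right 0. (k (w + complex_of_real t) - k w) / complex_of_real t = 1"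
      using eventually_at_right_less[of 0] by eventually_elim (use transl w in simp)
    ultimately have "((\<lambda>t. 1 :: complex) \<longlongrightarrow> deriv k w) (at_right (0::real))"
      by (rule Lim_transform_eventually)
    then have "deriv k w = 1" by (simp add: tendsto_const_iff)
    then show "((\<lambda>w. k w - w) has_field_derivative 0) (at w)"
      using d by (auto intro!: derivative_eq_intros)
  qed (use W in auto)
  then obtain c where "\<And>w. w \<in> W \<Longrightarrow> k w - w = c" by (auto simp: constant_on_def)
  then show ?thesis using that by (metis add.commute diff_add_cancel)
qed

lemma continuous_hull_translate:
  "continuous_hull ((\<lambda>w. w + c) ` W) = (\<lambda>w. w + c) ` continuous_hull W"
  unfolding continuous_hull_def by (force simp: image_iff algebra_simps)

lemma horizontal_translate:
  shows "horizontal_strip ((\<lambda>w. w + c) ` S) \<Longrightarrow> horizontal_strip S"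
    and "horizontal_half_plane ((\<lambda>w. w + c) ` S) \<Longrightarrow> horizontal_half_plane S"
    and "(\<lambda>w. w + c) ` S = UNIV \<Longrightarrow> S = UNIV"
proof -
  have mem: "w \<in> S \<longleftrightarrow> w + c \<in> (\<lambda>w. w + c) ` S" for w by auto
  show "horizontal_strip S" if "horizontal_strip ((\<lambda>w. w + c) ` S)"
  proof -
    obtain a b where ab: "a < b" "(\<lambda>w. w + c) ` S = {w. a < Im w \<and> Im w < b}"
      using \<open>horizontal_strip ((\<lambda>w. w + c) ` S)\<close> unfolding horizontal_strip_def by blast
    have "S = {w. a - Im c < Im w \<and> Im w < b - Im c}"
      using mem unfolding ab(2) by (auto simp: algebra_simps)
    then show ?thesis unfolding horizontal_strip_def using ab(1)
      by (intro exI[of _ "a - Im c"] exI[of _ "b - Im c"]) auto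
  qed
  show "horizontal_half_plane S" if half: "horizontal_half_plane ((\<lambda>w. w + c) ` S)"
  proof -
    obtain a where "(\<lambda>w. w + c) ` S = {w. a < Im w} \<or> (\<lambda>w. w + c) ` S = {w. Im w < a}"
      using half unfolding horizontal_half_plane_def by blast
    then have "S = {w. a - Im c < Im w} \<or> S = {w. Im w < a - Im c}"
    proof
      assume *: "(\<lambda>w. w + c) ` S = {w. a < Im w}"
      show ?thesis using mem unfolding * by (auto simp: algebra_simps)
    next
      assume *: "(\<lambda>w. w + c) ` S = {w. Im w < a}"
      show ?thesis using mem unfolding * by (auto simp: algebra_simps)
    qed
    then show ?thesis unfolding horizontal_half_plane_def by blast
  qed
  show "(\<lambda>w. w + c) ` S = UNIV \<Longrightarrow> S = UNIV"
    using mem by (metis UNIV_I UNIV_eq_I)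
qed

text \<open>Continuous time makes the transition map between two Koenigs functions commute with all small
  translations, so that it is rigid; a map alone only provides commutation with \<open>w \<mapsto> w + 1\<close>.\<close>

lemma semigroup_koenigs_unique:
  assumes h: "univalent_on h V" "open V" "connected V"
    and conj: "\<And>z t. z \<in> V \<Longrightarrow> t \<ge> 0 \<Longrightarrow> \<phi> t z \<in> V \<and> h (\<phi> t z) = h z + complex_of_real t"
    and g: "semigroup_koenigs_pair V \<phi> g \<Omega>"
  obtains c where "\<Omega> = (\<lambda>w. w + c) ` h ` V"
proof -
  have hol: "h holomorphic_on V" and inj: "inj_on h V" using h(1) unfolding univalent_on_def by auto
  obtain k where k: "k holomorphic_on (h ` V)" "\<And>z. z \<in> V \<Longrightarrow> k (h z) = z"
    using holomorphic_has_inverse[OF hol h(2) inj] by metis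
  have gV: "g holomorphic_on V" "g ` V = \<Omega>"
    "\<And>z t. z \<in> V \<Longrightarrow> t \<ge> 0 \<Longrightarrow> g (\<phi> t z) = g z + complex_of_real t"
    using g unfolding semigroup_koenigs_pair_def univalent_on_def by auto
  have "g \<circ> k holomorphic_on h ` V"
    using k gV by (intro holomorphic_on_compose_gen[of k _ g V]) auto
  moreover have "(g \<circ> k) (w + complex_of_real t) = (g \<circ> k) w + complex_of_real t"
    if w: "w \<in> h ` V" "t \<ge> 0" for w t
  proof -
    obtain z where z: "z \<in> V" "w = h z" using w by blast
    have "w + complex_of_real t = h (\<phi> t z)" "\<phi> t z \<in> V" using conj z w by auto
    then show ?thesis using z k(2) gV(3) w by simp
  qed
  moreover have "open (h ` V)" using open_mapping_thm3 h(2) hol inj by blast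
  moreover have "connected (h ` V)"
    using connected_continuous_image h(3) hol holomorphic_on_imp_continuous_on by blast
  ultimately obtain c where c: "\<And>w. w \<in> h ` V \<Longrightarrow> (g \<circ> k) w = w + c"
    using commuting_with_translations[of "h ` V" "g \<circ> k"] by blast
  have "g z = h z + c" if "z \<in> V" for z
    using c[of "h z"] k(2)[OF that] that by simp
  then have "\<Omega> = (\<lambda>w. w + c) ` h ` V"
    unfolding gV(2)[symmetric] image_image by (rule image_cong[OF refl])
  then show ?thesis using that by blast
qed

section \<open>Crosscuts on circles\<close>

text \<open>In the plane, a closed set that separates two points has a component that separates them.
  A simply connected domain is homeomorphic to the plane, which transports the statement.\<close>

lemma separating_component:
  fixes V K :: "complex set"
  assumes V: "open V" "simply_connected V" and K: "closedin (top_of_set V) K"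
    and ab: "a \<in> V" "b \<in> V" and sep: "\<not> connected_component (V - K) a b"
  obtains C where "C \<in> components K" "\<not> connected_component (V - C) a b"
proof -
  have "V homeomorphic (UNIV :: complex set)"
    using simply_connected_eq_homeomorphic_to_disc[OF V(1)] V(2) ab
      homeomorphic_ball01_UNIV homeomorphic_trans by blast
  then obtain p q where pq: "homeomorphism V (UNIV :: complex set) p q"
    unfolding homeomorphic_def by blast
  then have q_p: "\<And>x. x \<in> V \<Longrightarrow> q (p x) = x" and p_q: "\<And>y. p (q y) = y"
    and range_q: "range q = V" and contp: "continuous_on V p" and contq: "continuous_on UNIV q"
    unfolding homeomorphism_def by auto
  have KV: "K \<subseteq> V" using K closedin_imp_subset by blast
  define S where "S = p ` K"
  have closedS: "closed S"
    using homeomorphism_imp_closed_map[OF pq K] unfolding S_def by simp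
  have image_compl: "q ` (- X) \<subseteq> V - q ` X" for X
  proof -
    have "inj q" using p_q by (metis injI)
    then show ?thesis using range_q by (auto simp: inj_def)
  qed
  have pull: "connected_component (V - q ` X) a b" if c: "connected_component (- X) (p a) (p b)" for X
  proof -
    obtain T where T: "connected T" "T \<subseteq> - X" "p a \<in> T" "p b \<in> T"
      using c unfolding connected_component_def by blast
    have "connected (q ` T)"
      using T(1) contq connected_continuous_image continuous_on_subset by blast
    moreover have "q ` T \<subseteq> V - q ` X" using image_compl[of X] T(2) by blast
    moreover have "a \<in> q ` T" "b \<in> q ` T" using T q_p ab by (metis image_eqI)+
    ultimately show ?thesis unfolding connected_component_def by blast
  qed
  have qS: "q ` S = K"
    unfolding S_def using q_p KV by (force simp: image_image)
  have "\<not> connected_component (- S) (p a) (p b)"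
    using pull[of S] sep unfolding qS by blast
  then obtain D where D: "D \<in> components S" "\<not> connected_component (- D) (p a) (p b)"
    using separation_by_component_closed_pointwise[OF closedS] by blast
  have DS: "D \<subseteq> S" using D(1) in_components_subset by blast
  have pqD: "p ` q ` D = D" using p_q by (force simp: image_image)
  have "q ` D \<in> components K"
    unfolding in_components_maximal
  proof (intro conjI allI impI)
    show "q ` D \<noteq> {}" using D(1) in_components_nonempty by blast
    show "q ` D \<subseteq> K" using DS qS by blast
    show "connected (q ` D)"
      using D(1) in_components_connected contq connected_continuous_image continuous_on_subset
      by (metis subset_UNIV)
    fix E assume E: "E \<noteq> {} \<and> q ` D \<subseteq> E \<and> E \<subseteq> K \<and> connected E"
    have "connected (p ` E)"
      using E KV contp connected_continuous_image continuous_on_subset by (metis order_trans)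
    moreover have "D \<subseteq> p ` E" using E pqD by blast
    moreover have "p ` E \<subseteq> S" using E S_def by blast
    ultimately have "D = p ` E"
      using D(1) E unfolding in_components_maximal by (metis image_is_empty)
    then have "q ` D = q ` p ` E" by simp
    also have "\<dots> = E"
    proof -
      have "q (p x) = x" if "x \<in> E" for x using that q_p E KV by blast
      then show ?thesis by (simp add: image_image)
    qed
    finally show "E = q ` D" ..
  qed
  moreover have "\<not> connected_component (V - q ` D) a b"
  proof
    assume "connected_component (V - q ` D) a b"
    then obtain T where T: "connected T" "T \<subseteq> V - q ` D" "a \<in> T" "b \<in> T"
      unfolding connected_component_def by blast
    have "connected (p ` T)"
      using T contp connected_continuous_image continuous_on_subset by (metis Diff_subset order_trans)
    moreover have "p ` T \<subseteq> - D" using T(2) q_p by force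
    ultimately show False using D(2) T unfolding connected_component_def by blast
  qed
  ultimately show ?thesis using that by blast
qed

text \<open>A circle centred on the unit circle leaves the unit disc, so it is not contained in \<open>V\<close>. Cut at
  its point farthest from the origin, it is an interval of angles in \<open>(-\<pi>, \<pi>)\<close>; the components of
  its intersection with \<open>V\<close> correspond to open subintervals whose endpoints give points outside
  \<open>V\<close>, that is, boundary points at which the arc lands.\<close>

lemma circle_component_crosscut:
  assumes V: "open V" "V \<subseteq> unit_disc" and \<tau>: "\<tau> \<in> sphere 0 1" and r: "r > 0"
    and C: "C \<in> components (V \<inter> sphere \<tau> r)"
  shows "crosscut V C"
proof -
  \<comment> \<open>The angle \<open>\<pi>\<close> gives the point \<open>(1 + r) \<tau>\<close>, which lies outside the unit disc.\<close>
  define e where "e \<theta> = \<tau> - of_real r * \<tau> * cis \<theta>" for \<theta>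
  define L where "L y = Arg ((\<tau> - y) / (of_real r * \<tau>))" for y
  have \<tau>1: "cmod \<tau> = 1" and \<tau>0: "\<tau> \<noteq> 0" using \<tau> by auto
  have conte: "continuous_on X e" for X unfolding e_def by (intro continuous_intros)
  have e_sphere: "e \<theta> \<in> sphere \<tau> r" for \<theta>
    using r \<tau>1 by (simp add: e_def dist_norm norm_mult)
  have e_pi: "e pi \<notin> V" "e (- pi) \<notin> V"
  proof -
    have *: "e pi = of_real (1 + r) * \<tau>" "e (- pi) = of_real (1 + r) * \<tau>"
      by (simp_all add: e_def algebra_simps complex_eq_iff)
    have "cmod (of_real (1 + r) * \<tau>) = 1 + r"
      unfolding norm_mult norm_of_real using r \<tau>1 by simp
    then have "of_real (1 + r) * \<tau> \<notin> unit_disc" using r by simp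
    then show "e pi \<notin> V" "e (- pi) \<notin> V" using V(2) unfolding * by blast+
  qed
  have unit: "cmod ((\<tau> - y) / (of_real r * \<tau>)) = 1" if "y \<in> sphere \<tau> r" for y
    using that r \<tau>1 by (simp add: norm_divide norm_mult dist_norm)
  have eL: "e (L y) = y" if y: "y \<in> sphere \<tau> r" for y
  proof -
    have "cis (L y) = (\<tau> - y) / (of_real r * \<tau>)"
      unfolding L_def using unit[OF y] by (metis cis_Arg norm_zero sgn_eq div_by_1 of_real_1 zero_neq_one)
    then show ?thesis using r \<tau>0 by (simp add: e_def)
  qed
  have L_range: "L y \<in> {- pi<..<pi}" if y: "y \<in> V \<inter> sphere \<tau> r" for y
  proof -
    have "L y \<noteq> pi" using eL[of y] y e_pi by auto
    then show ?thesis using Arg_bounded[of "(\<tau> - y) / (of_real r * \<tau>)"] by (auto simp: L_def)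
  qed
  have Le: "L (e \<theta>) = \<theta>" if "\<theta> \<in> {- pi<..<pi}" for \<theta>
  proof -
    have "(\<tau> - e \<theta>) / (of_real r * \<tau>) = cis \<theta>" using r \<tau>0 by (simp add: e_def)
    then show ?thesis using that by (simp add: L_def Arg_cis)
  qed
  have contL: "continuous_on (V \<inter> sphere \<tau> r) L"
    unfolding L_def
  proof (rule continuous_on_compose2[of "{z. z \<notin> \<real>\<^sub>\<le>\<^sub>0}" Arg])
    show "continuous_on {z. z \<notin> \<real>\<^sub>\<le>\<^sub>0} Arg"
      by (intro continuous_at_imp_continuous_on ballI continuous_at_Arg) auto
    show "continuous_on (V \<inter> sphere \<tau> r) (\<lambda>y. (\<tau> - y) / (of_real r * \<tau>))"
      using r \<tau>0 by (intro continuous_intros) auto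
    show "(\<lambda>y. (\<tau> - y) / (of_real r * \<tau>)) ` (V \<inter> sphere \<tau> r) \<subseteq> {z. z \<notin> \<real>\<^sub>\<le>\<^sub>0}"
    proof clarify
      fix y assume y: "y \<in> V" "y \<in> sphere \<tau> r" "(\<tau> - y) / (of_real r * \<tau>) \<in> \<real>\<^sub>\<le>\<^sub>0"
      then obtain x where x: "x \<le> 0" "(\<tau> - y) / (of_real r * \<tau>) = of_real x"
        by (auto elim: nonpos_Reals_cases)
      then have "x = -1" using unit[OF y(2)] by simp
      then have "L y = pi" using x Arg_cis[of pi] by (simp add: L_def)
      then show False using L_range[of y] y by simp
    qed
  qed
  define T where "T = e -` V"
  have openT: "open T" unfolding T_def using conte V(1) by (intro open_vimage) auto
  obtain x where x: "x \<in> V \<inter> sphere \<tau> r" "C = connected_component_set (V \<inter> sphere \<tau> r) x"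
    using C unfolding components_def by blast
  define J where "J = connected_component_set T (L x)"
  have LxT: "L x \<in> T" using eL x by (simp add: T_def)
  have LxJ: "L x \<in> J" unfolding J_def using LxT by simp
  have connJ: "connected J" and JT: "J \<subseteq> T" and openJ: "open J"
    unfolding J_def using openT by (auto simp: connected_component_subset open_connected_component)
  have ivl: "\<And>a b x. a \<in> J \<Longrightarrow> b \<in> J \<Longrightarrow> a \<le> x \<Longrightarrow> x \<le> b \<Longrightarrow> x \<in> J"
    using connJ by (meson connected_contains_Icc atLeastAtMost_iff subsetD)
  have ends_out: "pi \<notin> J" "- pi \<notin> J" using JT e_pi by (auto simp: T_def)
  then have Jsub: "J \<subseteq> {- pi<..<pi}"
    using ivl LxJ L_range[OF x(1)]
    by (smt (verit, best) greaterThanLessThan_iff subsetI)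
  obtain a b where J: "J = {a<..<b}"
  proof -
    have "L x < pi" "- pi < L x" using L_range[OF x(1)] by auto
    then have "J \<noteq> UNIV" "J \<noteq> {..<c}" "J \<noteq> {c<..}" for c
      using ends_out LxJ by auto
    then show ?thesis
      using open_connected_real_cases[OF openJ connJ] LxJ that by (metis empty_iff)
  qed
  have less: "a < b" "L x \<in> {a<..<b}" using LxJ unfolding J by auto
  have ends: "a \<notin> T" "b \<notin> T"
  proof -
    have "a \<notin> J" "b \<notin> J" unfolding J by auto
    show "a \<notin> T"
    proof
      assume "a \<in> T"
      have "{a..<b} = insert a J" using less by (auto simp: J)
      then have "{a..<b} \<subseteq> T" using \<open>a \<in> T\<close> JT by simp
      then have "{a..<b} \<subseteq> J" unfolding J_def
        using less by (intro connected_component_maximal) auto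
      moreover have "a \<in> {a..<b}" using less by simp
      ultimately show False using \<open>a \<notin> J\<close> by blast
    qed
    show "b \<notin> T"
    proof
      assume "b \<in> T"
      have "{a<..b} = insert b J" using less by (auto simp: J)
      then have "{a<..b} \<subseteq> T" using \<open>b \<in> T\<close> JT by simp
      then have "{a<..b} \<subseteq> J" unfolding J_def
        using less by (intro connected_component_maximal) auto
      moreover have "b \<in> {a<..b}" using less by simp
      ultimately show False using \<open>b \<notin> J\<close> by blast
    qed
  qed
  have CeJ: "C = e ` J"
  proof
    show "e ` J \<subseteq> C"
      unfolding x(2)
    proof (rule connected_component_maximal)
      show "x \<in> e ` J" using LxJ eL[of x] x(1) by (metis IntE image_eqI)
      show "connected (e ` J)" using connJ conte by (intro connected_continuous_image)
      show "e ` J \<subseteq> V \<inter> sphere \<tau> r" using JT e_sphere by (auto simp: T_def)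
    qed
    have CK: "C \<subseteq> V \<inter> sphere \<tau> r" unfolding x(2) by (rule connected_component_subset)
    have "L ` C \<subseteq> J"
      unfolding J_def
    proof (rule connected_component_maximal)
      show "L x \<in> L ` C" using x by simp
      show "connected (L ` C)"
        using x(2) contL CK by (metis connected_connected_component connected_continuous_image continuous_on_subset)
      show "L ` C \<subseteq> T"
      proof (rule image_subsetI)
        fix y assume "y \<in> C"
        then have "y \<in> V" "y \<in> sphere \<tau> r" using CK by blast+
        then show "L y \<in> T" using eL[of y] by (simp add: T_def)
      qed
    qed
    show "C \<subseteq> e ` J"
    proof
      fix y assume y: "y \<in> C"
      then have "e (L y) = y" using CK eL[of y] by blast
      moreover have "L y \<in> J" using \<open>L ` C \<subseteq> J\<close> y by blast
      ultimately show "y \<in> e ` J" by (metis imageI)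
    qed
  qed
  define \<gamma> where "\<gamma> s = e (a + s * (b - a))" for s
  have contg: "continuous_on UNIV \<gamma>"
    unfolding \<gamma>_def e_def by (intro continuous_intros)
  have affine: "(\<lambda>s. a + s * (b - a)) ` {0<..<1} = {a<..<b}"
  proof
    show "{a<..<b} \<subseteq> (\<lambda>s. a + s * (b - a)) ` {0<..<1}"
    proof
      fix u assume u: "u \<in> {a<..<b}"
      show "u \<in> (\<lambda>s. a + s * (b - a)) ` {0<..<1}"
        using u less by (intro image_eqI[of _ _ "(u - a) / (b - a)"]) (auto simp: field_simps)
    qed
    show "(\<lambda>s. a + s * (b - a)) ` {0<..<1} \<subseteq> {a<..<b}"
    proof clarify
      fix s :: real assume s: "s \<in> {0<..<1}"
      have "0 < s * (b - a)" "s * (b - a) < 1 * (b - a)"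
        using s less by (auto intro!: mult_strict_right_mono)
      then show "a + s * (b - a) \<in> {a<..<b}" by auto
    qed
  qed
  have ecl: "e ` {a..b} \<subseteq> closure V"
  proof -
    have "e ` closure {a<..<b} \<subseteq> closure V"
      using conte JT closure_subset[of V] by (intro image_closure_subset) (auto simp: J T_def)
    then show ?thesis using less by simp
  qed
  have frontier: "e a \<in> frontier V" "e b \<in> frontier V"
    using ecl ends less V(1) by (auto simp: frontier_def interior_open T_def)
  have lim: "(\<gamma> \<longlongrightarrow> \<gamma> s) (at s within X)" for s X
    using contg by (meson UNIV_I continuous_on_def subset_UNIV tendsto_within_subset)
  show ?thesis
    unfolding crosscut_def
  proof (intro exI[of _ \<gamma>] conjI)
    show "continuous_on {0<..<1} \<gamma>" using contg continuous_on_subset by blast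
    show "inj_on \<gamma> {0<..<1}"
    proof (rule inj_onI)
      fix s t :: real assume st: "s \<in> {0<..<1}" "t \<in> {0<..<1}" "\<gamma> s = \<gamma> t"
      have "a + s * (b - a) \<in> {- pi<..<pi}" "a + t * (b - a) \<in> {- pi<..<pi}"
        using st affine Jsub unfolding J by blast+
      then have "a + s * (b - a) = a + t * (b - a)"
        using Le st(3) unfolding \<gamma>_def by metis
      then show "s = t" using less by simp
    qed
    show "\<gamma> ` {0<..<1} = C"
      unfolding CeJ J affine[symmetric] image_image \<gamma>_def ..
    show "C \<subseteq> V" using CeJ JT by (auto simp: T_def)
    show "lands_on_boundary V \<gamma> (at_right 0)"
      unfolding lands_on_boundary_def using lim[of 0] frontier(1) by (auto simp: \<gamma>_def)
    show "lands_on_boundary V \<gamma> (at_left 1)"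
      unfolding lands_on_boundary_def using lim[of 1] frontier(2) by (auto simp: \<gamma>_def)
  qed
qed

lemma circle_separates:
  fixes \<tau> :: complex
  assumes "dist \<tau> a > r" "dist \<tau> b < r"
  shows "\<not> connected_component (V - sphere \<tau> r) a b"
proof
  assume "connected_component (V - sphere \<tau> r) a b"
  then obtain X where X: "connected X" "X \<subseteq> V - sphere \<tau> r" "a \<in> X" "b \<in> X"
    unfolding connected_component_def by blast
  have "connected (dist \<tau> ` X)"
    by (intro connected_continuous_image X continuous_intros)
  then have "{dist \<tau> b..dist \<tau> a} \<subseteq> dist \<tau> ` X"
    using X by (intro connected_contains_Icc) auto
  then have "r \<in> dist \<tau> ` X" using assms by (auto simp: subset_iff)
  then show False using X by auto
qed

text \<open>The arc is relatively closed in \<open>V\<close>, so the visiting times form a closed set; they are bounded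
  because \<open>\<gamma>\<close> ends up strictly inside the circle.\<close>

lemma last_visit:
  fixes \<gamma> :: "real \<Rightarrow> complex"
  assumes \<gamma>: "continuous_on {0..} \<gamma>" "\<gamma> ` {0..} \<subseteq> V" "(\<gamma> \<longlongrightarrow> \<tau>) at_top"
    and A: "A \<in> components (V \<inter> sphere \<tau> r)" and r: "r > 0" and u: "0 \<le> u" "\<gamma> u \<in> A"
  obtains t where "t \<ge> u" "\<gamma> t \<in> A" "\<And>s. s > t \<Longrightarrow> \<gamma> s \<notin> A"
proof -
  define E where "E = {t \<in> {u..}. \<gamma> t \<in> A}"
  have Asub: "A \<subseteq> V \<inter> sphere \<tau> r" using A in_components_subset by blast
  have "closedin (top_of_set (V \<inter> sphere \<tau> r)) A" using A closedin_component by blast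
  moreover have "closedin (top_of_set V) (V \<inter> sphere \<tau> r)" by (simp add: closedin_closed_Int)
  ultimately have "closedin (top_of_set V) A" using closedin_trans by blast
  moreover have "continuous_on {u..} \<gamma>" using \<gamma>(1) u continuous_on_subset by fastforce
  moreover have "\<gamma> \<in> {u..} \<rightarrow> V" using \<gamma>(2) u by auto
  ultimately have "closedin (top_of_set {u..}) ({u..} \<inter> \<gamma> -` A)"
    by (intro continuous_closedin_preimage_gen)
  then have "closedin (top_of_set {u..}) E" by (simp add: E_def vimage_def Int_def)
  then have "closed E" using closedin_closed_trans closed_atLeast by blast
  obtain T where T: "\<And>s. s \<ge> T \<Longrightarrow> dist (\<gamma> s) \<tau> < r"
    using tendstoD[OF \<gamma>(3) r] unfolding eventually_at_top_linorder by blast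
  have "E \<subseteq> {u..T}"
  proof
    fix t assume t: "t \<in> E"
    then have "dist (\<gamma> t) \<tau> = r" using Asub by (auto simp: E_def dist_commute)
    then have "\<not> t \<ge> T" using T by fastforce
    then show "t \<in> {u..T}" using t by (auto simp: E_def)
  qed
  then have "compact E"
    using \<open>closed E\<close> bounded_closed_interval bounded_subset compact_eq_bounded_closed by blast
  moreover have "u \<in> E" using u by (simp add: E_def)
  ultimately obtain t where t: "t \<in> E" "\<And>s. s \<in> E \<Longrightarrow> s \<le> t"
    using compact_attains_sup by (metis empty_iff)
  show ?thesis
  proof
    show "t \<ge> u" "\<gamma> t \<in> A" using t by (auto simp: E_def)
    show "\<gamma> s \<notin> A" if "s > t" for s
      using t(2)[of s] that \<open>t \<ge> u\<close> by (auto simp: E_def)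
  qed
qed

section \<open>The prime end determined by a curve\<close>

text \<open>The whole circle separates \<open>\<gamma> t\<close> from the tail of the curve, hence one of its arcs in \<open>V\<close> does.
  Recording the last time at which the curve visits this arc makes it possible to iterate: from
  then on the curve stays in one component of the complement.\<close>

lemma next_arc:
  fixes \<gamma> :: "real \<Rightarrow> complex"
  assumes V: "open V" "simply_connected V"
    and \<gamma>: "continuous_on {0..} \<gamma>" "\<gamma> ` {0..} \<subseteq> V" "(\<gamma> \<longlongrightarrow> \<tau>) at_top"
    and t: "t \<ge> 0" and r: "0 < r" "r < dist \<tau> (\<gamma> t)"
  obtains A u where "A \<in> components (V \<inter> sphere \<tau> r)" "u > t" "\<gamma> u \<in> A"
    "\<And>s. s > u \<Longrightarrow> \<gamma> s \<notin> A" "\<And>s. s > u \<Longrightarrow> \<not> connected_component (V - A) (\<gamma> t) (\<gamma> s)"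
proof -
  define K where "K = V \<inter> sphere \<tau> r"
  obtain T0 where T0: "\<And>s. s \<ge> T0 \<Longrightarrow> dist (\<gamma> s) \<tau> < r"
    using tendstoD[OF \<gamma>(3) r(1)] unfolding eventually_at_top_linorder by blast
  define T where "T = max T0 t"
  have T: "T \<ge> t" "dist \<tau> (\<gamma> T) < r" using T0[of T] by (auto simp: T_def dist_commute)
  have VK: "V - K = V - sphere \<tau> r" by (auto simp: K_def)
  have "\<not> connected_component (V - K) (\<gamma> t) (\<gamma> T)"
    unfolding VK using circle_separates[OF r(2) T(2)] .
  moreover have "closedin (top_of_set V) K" by (simp add: K_def closedin_closed_Int)
  moreover have "\<gamma> t \<in> V" "\<gamma> T \<in> V" using \<gamma>(2) t T by auto
  ultimately obtain A where A: "A \<in> components K" and sep: "\<not> connected_component (V - A) (\<gamma> t) (\<gamma> T)"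
    using separating_component[OF V] by metis
  have path: "connected_component (V - A) (\<gamma> a) (\<gamma> b)"
    if "0 \<le> a" "a \<le> b" "\<And>s. a \<le> s \<Longrightarrow> s \<le> b \<Longrightarrow> \<gamma> s \<notin> A" for a b
    unfolding connected_component_def
  proof (intro exI[of _ "\<gamma> ` {a..b}"] conjI)
    show "connected (\<gamma> ` {a..b})"
      using \<gamma>(1) that(1) by (intro connected_continuous_image continuous_on_subset[OF \<gamma>(1)]) auto
    show "\<gamma> ` {a..b} \<subseteq> V - A" using \<gamma>(2) that by auto
  qed (use that in auto)
  obtain v where v: "t \<le> v" "v \<le> T" "\<gamma> v \<in> A" using path[OF t T(1)] sep by blast
  have "A \<in> components (V \<inter> sphere \<tau> r)" using A by (simp add: K_def)
  then obtain u where u: "u \<ge> v" "\<gamma> u \<in> A" "\<And>s. s > u \<Longrightarrow> \<gamma> s \<notin> A"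
    using last_visit[OF \<gamma> _ r(1) _ v(3)] t v(1) by (metis order_trans)
  have Asub: "A \<subseteq> sphere \<tau> r" using A in_components_subset unfolding K_def by blast
  have "\<gamma> t \<notin> A" using Asub r(2) by auto
  then have "v \<noteq> t" using v(3) by blast
  show ?thesis
  proof
    show "A \<in> components (V \<inter> sphere \<tau> r)" by fact
    show "u > t" using u v \<open>v \<noteq> t\<close> by linarith
    show "\<gamma> u \<in> A" "\<And>s. s > u \<Longrightarrow> \<gamma> s \<notin> A" by fact+
    show "\<not> connected_component (V - A) (\<gamma> t) (\<gamma> s)" if s: "s > u" for s
    proof -
      have uT: "u < T"
      proof (rule ccontr)
        assume "\<not> u < T"
        then have "dist (\<gamma> u) \<tau> < r" using T0[of u] by (simp add: T_def)
        then show False using u(2) Asub by (auto simp: dist_commute)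
      qed
      have "0 \<le> s" using s u v t by linarith
      have "connected_component (V - A) (\<gamma> s) (\<gamma> T)"
      proof (cases "s \<le> T")
        case True
        then show ?thesis using path[of s T] u(3) s \<open>0 \<le> s\<close> by simp
      next
        case False
        then have "connected_component (V - A) (\<gamma> T) (\<gamma> s)"
          using path[of T s] u(3) uT t T(1) by simp
        then show ?thesis by (rule connected_component_sym)
      qed
      then show ?thesis using sep connected_component_trans by metis
    qed
  qed
qed

lemma chordal_dist_le: "chordal_dist z w \<le> 2 * cmod (z - w)"
proof -
  have "1 \<le> sqrt (1 + (cmod z)\<^sup>2) * sqrt (1 + (cmod w)\<^sup>2)"
    using mult_mono[of 1 "sqrt (1 + (cmod z)\<^sup>2)" 1 "sqrt (1 + (cmod w)\<^sup>2)"] by simp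
  then have "2 * cmod (z - w) / (sqrt (1 + (cmod z)\<^sup>2) * sqrt (1 + (cmod w)\<^sup>2)) \<le> 2 * cmod (z - w) / 1"
    by (intro divide_left_mono) auto
  then show ?thesis by (simp add: chordal_dist_def)
qed

text \<open>Circular arcs with radii tending to 0 need not be nested, because the curve may approach
  its limit, retreat, and approach again. They are nested when each arc separates a point of its
  predecessor from the tail. The predecessor, being connected and disjoint from the arc, is then
  separated from the tail as a whole, and by induction so is the arc number 0: a connected set
  joining it to the tail inside the complement of a later arc would have to cross the
  predecessor of that arc. The next arc lies on the side of the tail because the curve meets it
  after its last visit to the present one.\<close>

lemma nested_arcs_separate:
  fixes A :: "nat \<Rightarrow> complex set" and \<gamma> :: "real \<Rightarrow> complex" and t :: "nat \<Rightarrow> real"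
  assumes sub: "\<And>n. A n \<subseteq> V" and conn: "\<And>n. connected (A n)"
    and disj: "\<And>m n. m \<noteq> n \<Longrightarrow> A m \<inter> A n = {}"
    and incr: "\<And>n. t n < t (Suc n)" and on: "\<And>n. \<gamma> (t n) \<in> A n"
    and tail: "\<And>n s s'. t n < s \<Longrightarrow> t n < s' \<Longrightarrow> connected_component (V - A n) (\<gamma> s) (\<gamma> s')"
    and sep: "\<And>n s. s > t (Suc n) \<Longrightarrow> \<not> connected_component (V - A (Suc n)) (\<gamma> (t n)) (\<gamma> s)"
  shows "n \<ge> 1 \<Longrightarrow> s > t n \<Longrightarrow> separates_in V (A n) (A 0) {\<gamma> s}"
    and "n \<ge> 1 \<Longrightarrow> separates_in V (A n) (A 0) (A (Suc n))"
proof -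
  have off: "connected_component (V - A n) x y" if "x \<in> A m" "y \<in> A m" "m \<noteq> n" for m n x y
    unfolding connected_component_def
  proof (intro exI[of _ "A m"] conjI)
    show "A m \<subseteq> V - A n" using sub disj[OF that(3)] by blast
  qed (use that conn in auto)
  have previous: "\<not> connected_component (V - A (Suc n)) x (\<gamma> s)" if "x \<in> A n" "s > t (Suc n)" for n x s
  proof
    assume "connected_component (V - A (Suc n)) x (\<gamma> s)"
    moreover have "connected_component (V - A (Suc n)) (\<gamma> (t n)) x" using off[OF on that(1)] by simp
    ultimately show False using sep[OF that(2)] connected_component_trans by metis
  qed
  have first: "\<not> connected_component (V - A (Suc n)) x (\<gamma> s)" if "x \<in> A 0" "s > t (Suc n)" for n x s
    using that
  proof (induction n arbitrary: x s)
    case 0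
    then show ?case using previous[of x 0 s] by simp
  next
    case (Suc n)
    show ?case
    proof
      assume "connected_component (V - A (Suc (Suc n))) x (\<gamma> s)"
      then obtain X where X: "connected X" "X \<subseteq> V - A (Suc (Suc n))" "x \<in> X" "\<gamma> s \<in> X"
        unfolding connected_component_def by blast
      show False
      proof (cases "X \<inter> A (Suc n) = {}")
        case True
        then have "connected_component (V - A (Suc n)) x (\<gamma> s)"
          using X unfolding connected_component_def by blast
        moreover have "s > t (Suc n)" using Suc.prems(2) incr[of "Suc n"] by linarith
        ultimately show False using Suc.IH[OF Suc.prems(1)] by blast
      next
        case False
        then obtain y where y: "y \<in> X" "y \<in> A (Suc n)" by blast
        then have "connected_component (V - A (Suc (Suc n))) y (\<gamma> s)"
          using X unfolding connected_component_def by blast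
        then show False using previous[OF y(2) Suc.prems(2)] by blast
      qed
    qed
  qed
  have first': "\<not> connected_component (V - A n) x (\<gamma> s)" if "n \<ge> 1" "x \<in> A 0" "s > t n" for n x s
    using first[of x "n - 1" s] that by simp
  have inside: "\<gamma> s \<in> V - A n" if "s > t n" for n s
    using tail[OF that that] connected_component_in by blast
  show "separates_in V (A n) (A 0) {\<gamma> s}" if "n \<ge> 1" "s > t n"
    unfolding separates_in_def using sub disj[of 0 n] inside first' that by auto
  show "separates_in V (A n) (A 0) (A (Suc n))" if n: "n \<ge> 1"
    unfolding separates_in_def
  proof (intro conjI ballI)
    show "A 0 \<subseteq> V - A n" "A (Suc n) \<subseteq> V - A n"
      using sub disj[of 0 n] disj[of "Suc n" n] n by auto
    fix a b assume ab: "a \<in> A 0" "b \<in> A (Suc n)"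
    have "connected_component (V - A n) b (\<gamma> (t (Suc n)))" using off[OF ab(2) on] by simp
    then show "\<not> connected_component (V - A n) a b"
      using first'[OF n ab(1) incr] connected_component_trans by metis
  qed
qed

text \<open>A curve that ends at a boundary point determines a prime end: the crosscuts are arcs of
  circles about the end point, with radii halved at each step. The second part says that every
  curve that is eventually joined to \<open>\<gamma>\<close> within small neighbourhoods of \<open>\<tau>\<close> converges
  to the same prime end.\<close>

lemma accessible_point_null_chain:
  fixes \<gamma> :: "real \<Rightarrow> complex"
  assumes V: "open V" "simply_connected V" "V \<subseteq> unit_disc" and \<tau>: "\<tau> \<in> sphere 0 1"
    and \<gamma>: "continuous_on {0..} \<gamma>" "\<gamma> ` {0..} \<subseteq> V" "(\<gamma> \<longlongrightarrow> \<tau>) at_top"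
  shows "\<exists>C. null_chain V C \<and>
    (\<forall>\<eta>. (\<forall>r>0. \<forall>\<^sub>F s in at_top. connected_component (V \<inter> ball \<tau> r) (\<gamma> s) (\<eta> s))
       \<longrightarrow> converges_to_prime_end V C \<eta>)"
proof -
  define r where "r n = dist \<tau> (\<gamma> 0) / 2 ^ n" for n :: nat
  have "\<gamma> 0 \<in> V" using \<gamma>(2) by auto
  then have "\<gamma> 0 \<noteq> \<tau>" using V(3) \<tau> by auto
  then have r0: "r n > 0" for n by (simp add: r_def)
  have rSuc: "r (Suc n) < r n" for n using r0[of n] by (simp add: r_def field_simps)
  have r_inj: "r m \<noteq> r n" if "m \<noteq> n" for m n
    using that \<open>\<gamma> 0 \<noteq> \<tau>\<close> by (simp add: r_def)
  have rlim: "r \<longlonglongrightarrow> 0"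
    unfolding r_def by (rule LIMSEQ_divide_realpow_zero) simp
  \<comment> \<open>The arcs are chosen one after the other, each together with the last time at which the curve
    visits it.\<close>
  define P where "P n At \<longleftrightarrow> (case At of (A, t) \<Rightarrow> t \<ge> 0 \<and> A \<in> components (V \<inter> sphere \<tau> (r n)) \<and>
      \<gamma> t \<in> A \<and> (\<forall>s>t. \<gamma> s \<notin> A))" for n and At :: "complex set \<times> real"
  define Q where "Q n At Bu \<longleftrightarrow> (case At of (A, t) \<Rightarrow> case Bu of (B, u) \<Rightarrow> t < u \<and>
      (\<forall>s>u. \<not> connected_component (V - B) (\<gamma> t) (\<gamma> s)))" for n :: nat and At Bu :: "complex set \<times> real"
  have "\<exists>At. \<forall>n. P n (At n) \<and> Q n (At n) (At (Suc n))"
  proof (rule dependent_nat_choice)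
    have g0: "\<gamma> 0 \<in> V \<inter> sphere \<tau> (r 0)" using \<open>\<gamma> 0 \<in> V\<close> by (simp add: r_def)
    define A where "A = connected_component_set (V \<inter> sphere \<tau> (r 0)) (\<gamma> 0)"
    have A: "A \<in> components (V \<inter> sphere \<tau> (r 0))" unfolding A_def using g0 by (rule componentsI)
    have "\<gamma> 0 \<in> A" unfolding A_def using g0 by simp
    then obtain t where "t \<ge> 0" "\<gamma> t \<in> A" "\<And>s. s > t \<Longrightarrow> \<gamma> s \<notin> A"
      using last_visit[OF \<gamma> A r0 order_refl] by blast
    then have "P 0 (A, t)" using A by (simp add: P_def)
    then show "\<exists>At. P 0 At" by blast
  next
    fix At n assume P: "P n At"
    obtain A t where At: "At = (A, t)" by (cases At)
    have t: "t \<ge> 0" "A \<in> components (V \<inter> sphere \<tau> (r n))" "\<gamma> t \<in> A"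
      using P by (auto simp: P_def At)
    then have "\<gamma> t \<in> sphere \<tau> (r n)" using in_components_subset by blast
    then have "r (Suc n) < dist \<tau> (\<gamma> t)" using rSuc[of n] by simp
    then obtain B u where B: "B \<in> components (V \<inter> sphere \<tau> (r (Suc n)))" "u > t" "\<gamma> u \<in> B"
      "\<And>s. s > u \<Longrightarrow> \<gamma> s \<notin> B" "\<And>s. s > u \<Longrightarrow> \<not> connected_component (V - B) (\<gamma> t) (\<gamma> s)"
      using next_arc[OF V(1,2) \<gamma> t(1) r0] by blast
    then have "P (Suc n) (B, u) \<and> Q n At (B, u)" using t(1) by (auto simp: P_def Q_def At)
    then show "\<exists>Bu. P (Suc n) Bu \<and> Q n At Bu" by blast
  qed
  then obtain At where At: "\<And>n. P n (At n)" "\<And>n. Q n (At n) (At (Suc n))" by blast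
  define A where "A n = fst (At n)" for n
  define t where "t n = snd (At n)" for n
  have A: "A n \<in> components (V \<inter> sphere \<tau> (r n))" and t0: "t n \<ge> 0" and on: "\<gamma> (t n) \<in> A n"
    and after: "\<And>s. s > t n \<Longrightarrow> \<gamma> s \<notin> A n" for n
    using At(1)[of n] by (auto simp: P_def A_def t_def split: prod.splits)
  have incr: "t n < t (Suc n)"
    and sep: "\<And>s. s > t (Suc n) \<Longrightarrow> \<not> connected_component (V - A (Suc n)) (\<gamma> (t n)) (\<gamma> s)" for n
    using At(2)[of n] by (auto simp: Q_def A_def t_def split: prod.splits)
  have Asub: "A n \<subseteq> V" "A n \<subseteq> sphere \<tau> (r n)" for n
    using A[of n] in_components_subset by blast+
  have disj: "A m \<inter> A n = {}" if "m \<noteq> n" for m n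
    using Asub(2)[of m] Asub(2)[of n] r_inj[OF that] by (auto simp: subset_iff)
  have tail: "connected_component (V - A n) (\<gamma> s) (\<gamma> s')" if s: "t n < s" "t n < s'" for n s s'
  proof -
    have ordered: "connected_component (V - A n) (\<gamma> s) (\<gamma> s')" if "t n < s" "s \<le> s'" for s s'
      unfolding connected_component_def
    proof (intro exI[of _ "\<gamma> ` {s..s'}"] conjI)
      show "connected (\<gamma> ` {s..s'})"
        using that(1) t0[of n]
        by (intro connected_continuous_image continuous_on_subset[OF \<gamma>(1)]) auto
      show "\<gamma> ` {s..s'} \<subseteq> V - A n" using \<gamma>(2) that(1) t0[of n] after[of n] by (auto simp: subset_iff)
    qed (use that in auto)
    show ?thesis
      using ordered[of s s'] ordered[of s' s] s connected_component_sym by (cases "s \<le> s'") auto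
  qed
  have conn: "connected (A n)" for n using A in_components_connected by blast
  have beyond: "separates_in V (A n) (A 0) {\<gamma> s}" if "n \<ge> 1" "s > t n" for n s
    by (rule nested_arcs_separate(1)[where t = t and \<gamma> = \<gamma>])
      (fact Asub(1) conn disj incr on tail sep that)+
  have nested: "separates_in V (A n) (A 0) (A (Suc n))" if "n \<ge> 1" for n
    by (rule nested_arcs_separate(2)[where t = t and \<gamma> = \<gamma>])
      (fact Asub(1) conn disj incr on tail sep that)+
  have "null_chain V A"
    unfolding null_chain_def
  proof (intro conjI allI impI)
    show "crosscut V (A n)" for n
      using circle_component_crosscut[OF V(1,3) \<tau> r0 A] .
    show "closure (A n) \<inter> closure (A (Suc n)) = {}" for n
    proof -
      have "closure (A m) \<subseteq> sphere \<tau> (r m)" for m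
        using Asub(2) by (intro closure_minimal) auto
      moreover have "sphere \<tau> (r n) \<inter> sphere \<tau> (r (Suc n)) = {}"
        using rSuc[of n] by auto
      ultimately show ?thesis by blast
    qed
    show "bounded (A n) \<or> bounded (A (Suc n))" for n
      using Asub(2) bounded_sphere bounded_subset by blast
    show "separates_in V (A n) (A 0) (A (Suc n))" if "n \<ge> 1" for n
      by (rule nested[OF that])
    show "\<forall>\<^sub>F n in sequentially. \<forall>z\<in>A n. \<forall>w\<in>A n. chordal_dist z w < \<epsilon>" if "\<epsilon> > 0" for \<epsilon>
    proof -
      have "\<forall>\<^sub>F n in sequentially. r n < \<epsilon> / 4"
        using order_tendstoD(2)[OF rlim, of "\<epsilon> / 4"] that by simp
      then show ?thesis
      proof eventually_elim
        case (elim n)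
        show ?case
        proof (intro ballI)
          fix z w assume "z \<in> A n" "w \<in> A n"
          then have "z \<in> sphere \<tau> (r n)" "w \<in> sphere \<tau> (r n)" using Asub(2) by blast+
          then have "dist \<tau> z = r n" "dist \<tau> w = r n" by simp_all
          then have "cmod (z - w) \<le> 2 * r n"
            by (metis dist_commute dist_norm dist_triangle2 mult_2)
          then show "chordal_dist z w < \<epsilon>" using chordal_dist_le[of z w] elim by linarith
        qed
      qed
    qed
  qed
  moreover have "converges_to_prime_end V A \<eta>"
    if \<eta>: "\<forall>r>0. \<forall>\<^sub>F s in at_top. connected_component (V \<inter> ball \<tau> r) (\<gamma> s) (\<eta> s)" for \<eta>
    unfolding converges_to_prime_end_def
  proof (intro allI impI)
    fix n :: nat assume n: "n \<ge> 1"
    show "\<forall>\<^sub>F s in at_top. separates_in V (A n) (A 0) {\<eta> s}"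
      using \<eta>[rule_format, OF r0[of n]] eventually_gt_at_top[of "t n"]
    proof eventually_elim
      case (elim s)
      have "V \<inter> ball \<tau> (r n) \<subseteq> V - A n" using Asub(2)[of n] by auto
      then have c: "connected_component (V - A n) (\<gamma> s) (\<eta> s)"
        using elim(1) connected_component_of_subset by blast
      then have c': "connected_component (V - A n) (\<eta> s) (\<gamma> s)" by (rule connected_component_sym)
      have "separates_in V (A n) (A 0) {\<gamma> s}" by (rule beyond[OF n elim(2)])
      then show ?case
        using c connected_component_in[OF c] connected_component_trans[OF _ c']
        unfolding separates_in_def by blast
    qed
  qed
  ultimately show ?thesis by blast
qed

section \<open>Iterates on compact sets\<close>

lemma iterate_holomorphic:
  assumes "f holomorphic_on unit_disc" "f ` unit_disc \<subseteq> unit_disc"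
  shows "(f ^^ n) holomorphic_on unit_disc"
proof (induction n)
  case (Suc n)
  have "(f ^^ n) ` unit_disc \<subseteq> unit_disc" using iterate_in_disc[OF assms(2)] by blast
  then have "f \<circ> (f ^^ n) holomorphic_on unit_disc"
    using holomorphic_on_compose_gen[OF Suc assms(1)] by blast
  then show ?case by (simp only: funpow.simps)
qed simp

text \<open>The orbit of \<open>0\<close> controls all others: the distance of the \<open>n\<close>-th iterates is at most a
  constant times \<open>1 - \<bar>f\<^sup>n 0\<bar>\<close>, which tends to 0.\<close>

lemma iterates_uniform_limit:
  assumes f: "f holomorphic_on unit_disc" "f ` unit_disc \<subseteq> unit_disc"
    and \<tau>: "denjoy_wolff_point f \<tau>" and L: "compact L" "L \<subseteq> unit_disc" and r: "r > 0"
  shows "\<forall>\<^sub>F n in sequentially. \<forall>b\<in>L. dist \<tau> ((f ^^ n) b) < r"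
proof -
  obtain M where M: "M > 0" "\<And>F b. F holomorphic_on unit_disc \<Longrightarrow> F ` unit_disc \<subseteq> unit_disc \<Longrightarrow> b \<in> L \<Longrightarrow>
       cmod (F 0 - F b) \<le> M * (1 - cmod (F 0)) \<and> cmod (F 0 - F b) \<le> M * (1 - cmod (F b))"
    using orbit_comparison[of 0 L] L by auto
  have lim: "(\<lambda>n. (f ^^ n) 0) \<longlonglongrightarrow> \<tau>" and "cmod \<tau> = 1"
    using \<tau> unfolding denjoy_wolff_point_def by auto
  have "(\<lambda>n. dist \<tau> ((f ^^ n) 0) + M * (1 - cmod ((f ^^ n) 0))) \<longlonglongrightarrow> dist \<tau> \<tau> + M * (1 - cmod \<tau>)"
    by (intro tendsto_intros lim)
  then have "\<forall>\<^sub>F n in sequentially. dist \<tau> ((f ^^ n) 0) + M * (1 - cmod ((f ^^ n) 0)) < r"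
    using \<open>cmod \<tau> = 1\<close> r by (intro order_tendstoD(2)) auto
  then show ?thesis
  proof eventually_elim
    case (elim n)
    show ?case
    proof
      fix b assume "b \<in> L"
      have "(f ^^ n) ` unit_disc \<subseteq> unit_disc" using iterate_in_disc[OF f(2)] by blast
      then have "cmod ((f ^^ n) 0 - (f ^^ n) b) \<le> M * (1 - cmod ((f ^^ n) 0))"
        using M(2)[OF iterate_holomorphic[OF f] _ \<open>b \<in> L\<close>] by blast
      then show "dist \<tau> ((f ^^ n) b) < r"
        using elim dist_triangle[of \<tau> "(f ^^ n) b" "(f ^^ n) 0"] by (simp add: dist_norm)
    qed
  qed
qed

text \<open>A neighbourhood of bounded hyperbolic radius of a Stolz region lies in a larger Stolz region
  at the same point.\<close>

lemma iterates_in_common_stolz_region: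
  assumes f: "f holomorphic_on unit_disc" "f ` unit_disc \<subseteq> unit_disc"
    and \<tau>: "cmod \<tau> = 1" and a: "a \<in> unit_disc" and L: "compact L" "L \<subseteq> unit_disc"
    and nt: "nontangential_seq (\<lambda>n. (f ^^ n) a) \<tau>"
  obtains R where "R > 1" "\<And>n b. b \<in> L \<Longrightarrow> (f ^^ n) b \<in> stolz_region \<tau> R"
proof -
  obtain M where M: "M > 0" "\<And>F b. F holomorphic_on unit_disc \<Longrightarrow> F ` unit_disc \<subseteq> unit_disc \<Longrightarrow> b \<in> L \<Longrightarrow>
       cmod (F a - F b) \<le> M * (1 - cmod (F a)) \<and> cmod (F a - F b) \<le> M * (1 - cmod (F b))"
    using orbit_comparison[OF a L] by blast
  obtain R0 where R0: "R0 > 1" "\<And>n. n \<ge> 1 \<Longrightarrow> (f ^^ n) a \<in> stolz_region \<tau> R0"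
    using nt unfolding nontangential_seq_def by blast
  have a1: "cmod a < 1" using a by simp
  \<comment> \<open>The sequence is only controlled from index 1 on; the second argument of the maximum takes
    care of index 0.\<close>
  define R1 where "R1 = max R0 (3 / (1 - cmod a))"
  have R1: "R1 > 1" using R0 by (simp add: R1_def)
  have stolz: "cmod (\<tau> - (f ^^ n) a) < R1 * (1 - cmod ((f ^^ n) a))" for n
  proof (cases "n = 0")
    case True
    have "cmod (\<tau> - a) \<le> 1 + 1" using norm_triangle_ineq4[of \<tau> a] \<tau> a1 by linarith
    also have "1 + 1 < 3 / (1 - cmod a) * (1 - cmod a)"
    proof -
      have "3 / (1 - cmod a) * (1 - cmod a) = 3" using a1 by (subst nonzero_eq_divide_eq[symmetric]) auto
      then show ?thesis by linarith
    qed
    also have "\<dots> \<le> R1 * (1 - cmod a)" using a1 by (intro mult_right_mono) (auto simp: R1_def)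
    finally show ?thesis using True by simp
  next
    case False
    then have "(f ^^ n) a \<in> stolz_region \<tau> R0" using R0 by simp
    then have "cmod (\<tau> - (f ^^ n) a) < R0 * (1 - cmod ((f ^^ n) a))" "cmod ((f ^^ n) a) < 1"
      by (auto simp: stolz_region_def)
    moreover from this have "R0 * (1 - cmod ((f ^^ n) a)) \<le> R1 * (1 - cmod ((f ^^ n) a))"
      by (intro mult_right_mono) (auto simp: R1_def)
    ultimately show ?thesis by linarith
  qed
  show ?thesis
  proof
    have "1 * 1 \<le> R1 * (1 + M)" using R1 M(1) by (intro mult_mono) auto
    then show "R1 * (1 + M) + M > 1" using M(1) by linarith
    fix n b assume b: "b \<in> L"
    define A B where "A = (f ^^ n) a" and "B = (f ^^ n) b"
    have "(f ^^ n) ` unit_disc \<subseteq> unit_disc" using iterate_in_disc[OF f(2)] by blast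
    then have AB: "cmod (A - B) \<le> M * (1 - cmod B)"
      using M(2)[OF iterate_holomorphic[OF f] _ b] unfolding A_def B_def by blast
    have "1 - cmod A \<le> (1 - cmod B) + cmod (A - B)"
      using norm_triangle_sub[of B A] by (simp add: norm_minus_commute)
    then have "1 - cmod A \<le> (1 + M) * (1 - cmod B)" using AB by (simp add: algebra_simps)
    then have "R1 * (1 - cmod A) \<le> R1 * ((1 + M) * (1 - cmod B))" using R1 by simp
    moreover have "cmod (\<tau> - B) \<le> cmod (\<tau> - A) + cmod (A - B)"
      using norm_triangle_ineq[of "\<tau> - A" "A - B"] by simp
    ultimately have "cmod (\<tau> - B) < R1 * ((1 + M) * (1 - cmod B)) + M * (1 - cmod B)"
      using stolz[of n] AB unfolding A_def[symmetric] by linarith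
    moreover have "B \<in> unit_disc" unfolding B_def using iterate_in_disc[OF f(2)] L b by blast
    ultimately show "(f ^^ n) b \<in> stolz_region \<tau> (R1 * (1 + M) + M)"
      unfolding stolz_region_def B_def by (simp add: algebra_simps)
  qed
qed

section \<open>Flows conjugate to translations\<close>

text \<open>The flow is specified by its effect in the coordinate \<open>h\<close>, where it is the translation by
  \<open>t\<close>; injectivity of \<open>h\<close> turns every identity between translations into one for \<open>\<phi>\<close>.\<close>

locale linearised_flow =
  fixes V :: "complex set" and h :: "complex \<Rightarrow> complex" and \<phi> :: "real \<Rightarrow> complex \<Rightarrow> complex"
  assumes domain: "is_domain V" and univalent: "univalent_on h V"
    and flow_in: "\<And>z t. z \<in> V \<Longrightarrow> t \<ge> 0 \<Longrightarrow> \<phi> t z \<in> V"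
    and flow_eq: "\<And>z t. z \<in> V \<Longrightarrow> t \<ge> 0 \<Longrightarrow> h (\<phi> t z) = h z + complex_of_real t"
begin

lemma h_hol: "h holomorphic_on V" and h_inj: "inj_on h V"
  and V_open: "open V" and V_connected: "connected V" and V_nonempty: "V \<noteq> {}"
  using univalent domain unfolding univalent_on_def is_domain_def by auto

lemma flow_unique: "z \<in> V \<Longrightarrow> t \<ge> 0 \<Longrightarrow> w \<in> V \<Longrightarrow> h w = h z + complex_of_real t \<Longrightarrow> \<phi> t z = w"
  using h_inj flow_in flow_eq by (metis inj_onD)

lemma flow_0: "z \<in> V \<Longrightarrow> \<phi> 0 z = z"
  by (rule flow_unique) auto

lemma flow_add: "z \<in> V \<Longrightarrow> t \<ge> 0 \<Longrightarrow> s \<ge> 0 \<Longrightarrow> \<phi> (t + s) z = \<phi> t (\<phi> s z)"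
  by (rule flow_unique) (auto simp: flow_in flow_eq)

definition h_inv where "h_inv = the_inv_into V h"

lemma h_inv_h: "z \<in> V \<Longrightarrow> h_inv (h z) = z"
  unfolding h_inv_def using h_inj by (simp add: the_inv_into_f_f)

lemma h_inv_hol: "h_inv holomorphic_on h ` V"
proof -
  obtain g where "g holomorphic_on h ` V" "\<And>z. z \<in> V \<Longrightarrow> g (h z) = z"
    using holomorphic_has_inverse[OF h_hol V_open h_inj] by metis
  then show ?thesis using h_inv_h by (elim holomorphic_transform) auto
qed

lemma flow_h_inv: "z \<in> V \<Longrightarrow> t \<ge> 0 \<Longrightarrow> \<phi> t z = h_inv (h z + complex_of_real t)"
  using h_inv_h[OF flow_in] flow_eq by metis

lemma flow_domain: "z \<in> V \<Longrightarrow> t \<ge> 0 \<Longrightarrow> h z + complex_of_real t \<in> h ` V"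
  using flow_in flow_eq by (metis imageI)

lemma flow_continuous: "continuous_on ({0..} \<times> V) (\<lambda>(t, z). \<phi> t z)"
proof -
  have "continuous_on ({0..} \<times> V) (\<lambda>p. h_inv (h (snd p) + complex_of_real (fst p)))"
  proof (rule continuous_on_compose2[OF holomorphic_on_imp_continuous_on[OF h_inv_hol]])
    show "continuous_on ({0..} \<times> V) (\<lambda>p. h (snd p) + complex_of_real (fst p))"
      by (intro continuous_intros continuous_on_compose2[OF holomorphic_on_imp_continuous_on[OF h_hol]]) auto
  qed (auto intro: flow_domain)
  then show ?thesis
    by (rule continuous_on_eq) (auto simp: flow_h_inv)
qed

lemma trajectory_continuous:
  assumes "z \<in> V" shows "continuous_on {0..} (\<lambda>t. \<phi> t z)"
proof -
  have "continuous_on {0..} (\<lambda>t. (\<lambda>(t, z). \<phi> t z) (t, z))"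
    by (rule continuous_on_compose2[OF flow_continuous]) (use assms in \<open>auto intro: continuous_on_Pair\<close>)
  then show ?thesis by simp
qed

lemma flow_map_continuous:
  assumes "t \<ge> 0" shows "continuous_on V (\<phi> t)"
proof -
  have "continuous_on V (\<lambda>z. (\<lambda>(t, z). \<phi> t z) (t, z))"
    by (rule continuous_on_compose2[OF flow_continuous]) (use assms in \<open>auto intro: continuous_on_Pair\<close>)
  then show ?thesis by simp
qed

lemma flow_holomorphic: assumes "t \<ge> 0" shows "\<phi> t holomorphic_on V"
proof -
  have "h_inv \<circ> (\<lambda>z. h z + complex_of_real t) holomorphic_on V"
    using flow_domain assms
    by (intro holomorphic_on_compose_gen[OF _ h_inv_hol] holomorphic_intros h_hol) auto
  then show ?thesis by (rule holomorphic_transform) (simp add: flow_h_inv assms)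
qed

lemma flow_semigroup:
  assumes "simply_connected V" "V \<noteq> UNIV"
  shows "semigroup_in V \<phi>"
proof -
  have "((\<lambda>t. \<phi> t z) \<longlongrightarrow> z) (at_right 0)" if z: "z \<in> V" for z
  proof -
    have "((\<lambda>t. \<phi> t z) \<longlongrightarrow> \<phi> 0 z) (at 0 within {0..})"
      using trajectory_continuous[OF z] unfolding continuous_on_def by simp
    then show ?thesis
      unfolding flow_0[OF z] by (rule tendsto_within_subset) auto
  qed
  then show ?thesis
    unfolding semigroup_in_def
    using domain assms flow_holomorphic flow_in flow_0 flow_add by auto
qed

text \<open>Otherwise the inverse of \<open>h\<close> would be a bounded entire function.\<close>

lemma image_not_UNIV:
  assumes "bounded V" shows "h ` V \<noteq> UNIV"
proof
  assume U: "h ` V = UNIV"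
  have "range h_inv \<subseteq> V" using h_inv_h unfolding U[symmetric] by auto
  then have "bounded (range h_inv)" using assms bounded_subset by blast
  moreover have "h_inv holomorphic_on UNIV" using h_inv_hol U by simp
  ultimately have "h_inv constant_on UNIV" by (intro Liouville_theorem)
  then obtain c where c: "\<And>w. h_inv w = c" by (auto simp: constant_on_def)
  obtain z where z: "z \<in> V" using V_nonempty by blast
  have "\<phi> 1 z = z" using flow_h_inv[OF z] h_inv_h[OF z] c by simp
  then show False using flow_eq[OF z, of 1] by simp
qed

lemma hull_type:
  assumes "semigroup_koenigs_pair V \<phi> g \<Omega>"
  shows "horizontal_strip (continuous_hull \<Omega>) \<Longrightarrow> horizontal_strip (continuous_hull (h ` V))"
    and "horizontal_half_plane (continuous_hull \<Omega>) \<Longrightarrow> horizontal_half_plane (continuous_hull (h ` V))"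
    and "continuous_hull \<Omega> = UNIV \<Longrightarrow> continuous_hull (h ` V) = UNIV"
proof -
  obtain c where c: "\<Omega> = (\<lambda>w. w + c) ` h ` V"
    using semigroup_koenigs_unique[OF univalent V_open V_connected _ assms] flow_in flow_eq by metis
  show "horizontal_strip (continuous_hull \<Omega>) \<Longrightarrow> horizontal_strip (continuous_hull (h ` V))"
    and "horizontal_half_plane (continuous_hull \<Omega>) \<Longrightarrow> horizontal_half_plane (continuous_hull (h ` V))"
    and "continuous_hull \<Omega> = UNIV \<Longrightarrow> continuous_hull (h ` V) = UNIV"
    unfolding c continuous_hull_translate using horizontal_translate by metis+
qed

lemma semigroup_type:
  assumes star: "starlike_at_infinity (h ` V)" and ne: "non_elliptic_semigroup V \<phi>"
    and not_UNIV: "h ` V \<noteq> UNIV"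
  shows "hyperbolic_semigroup V \<phi> \<longleftrightarrow> horizontal_strip (continuous_hull (h ` V))"
    and "parabolic_pos_step_semigroup V \<phi> \<longleftrightarrow> horizontal_half_plane (continuous_hull (h ` V))"
    and "parabolic_zero_step_semigroup V \<phi> \<longleftrightarrow> continuous_hull (h ` V) = UNIV"
proof -
  have pair: "semigroup_koenigs_pair V \<phi> h (h ` V)"
    unfolding semigroup_koenigs_pair_def using star not_UNIV univalent flow_eq by auto
  show "hyperbolic_semigroup V \<phi> \<longleftrightarrow> horizontal_strip (continuous_hull (h ` V))"
    unfolding hyperbolic_semigroup_def using ne pair hull_type(1) by blast
  show "parabolic_pos_step_semigroup V \<phi> \<longleftrightarrow> horizontal_half_plane (continuous_hull (h ` V))"
    unfolding parabolic_pos_step_semigroup_def using ne pair hull_type(2) by blast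
  show "parabolic_zero_step_semigroup V \<phi> \<longleftrightarrow> continuous_hull (h ` V) = UNIV"
    unfolding parabolic_zero_step_semigroup_def using ne pair hull_type(3) by blast
qed

text \<open>A path from \<open>z0\<close> to \<open>z\<close> is carried by the flow into every neighbourhood of \<open>\<tau>\<close>, and there it
  joins the two trajectories inside \<open>V\<close>. Hence all trajectories converge to the prime end that
  one of them determines.\<close>

lemma flow_converges_to_prime_end:
  assumes sc: "simply_connected V" "V \<subseteq> unit_disc" and \<tau>: "\<tau> \<in> sphere 0 1"
    and unif: "\<And>K r. compact K \<Longrightarrow> K \<subseteq> V \<Longrightarrow> r > 0 \<Longrightarrow> \<forall>\<^sub>F t in at_top. \<forall>z\<in>K. dist \<tau> (\<phi> t z) < r"
  shows "non_elliptic_semigroup V \<phi>"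
proof -
  obtain z0 where z0: "z0 \<in> V" using V_nonempty by blast
  have "((\<lambda>t. \<phi> t z0) \<longlongrightarrow> \<tau>) at_top"
    using unif[of "{z0}"] z0 by (intro tendstoI) (simp add: dist_commute)
  moreover have "(\<lambda>t. \<phi> t z0) ` {0..} \<subseteq> V" using flow_in[OF z0] by auto
  ultimately obtain C where C: "null_chain V C"
    "\<forall>\<eta>. (\<forall>r>0. \<forall>\<^sub>F s in at_top. connected_component (V \<inter> ball \<tau> r) (\<phi> s z0) (\<eta> s))
       \<longrightarrow> converges_to_prime_end V C \<eta>"
    using accessible_point_null_chain[OF V_open sc \<tau> trajectory_continuous[OF z0]] by blast
  have "converges_to_prime_end V C (\<lambda>t. \<phi> t z)" if z: "z \<in> V" for z
  proof (rule C(2)[rule_format])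
    fix r :: real assume r: "r > 0"
    have "path_connected V" using V_open V_connected connected_open_path_connected by blast
    then obtain g where g: "path g" "path_image g \<subseteq> V" "pathstart g = z0" "pathfinish g = z"
      using z0 z unfolding path_connected_def by blast
    define X where "X = path_image g"
    have X: "compact X" "connected X" "X \<subseteq> V" "z0 \<in> X" "z \<in> X"
      using g compact_path_image connected_path_image pathstart_in_path_image pathfinish_in_path_image
      unfolding X_def by blast+
    show "\<forall>\<^sub>F t in at_top. connected_component (V \<inter> ball \<tau> r) (\<phi> t z0) (\<phi> t z)"
      using unif[OF X(1,3) r] eventually_ge_at_top[of 0]
    proof eventually_elim
      case (elim t)
      have "connected (\<phi> t ` X)"
        using X flow_map_continuous[OF elim(2)] continuous_on_subset connected_continuous_image by blast
      moreover have "\<phi> t ` X \<subseteq> V \<inter> ball \<tau> r" using elim X(3) flow_in by auto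
      ultimately show ?case unfolding connected_component_def using X by blast
    qed
  qed
  moreover have "V \<noteq> UNIV" using sc(2) bounded_ball bounded_subset not_bounded_UNIV by metis
  ultimately show ?thesis
    unfolding non_elliptic_semigroup_def using flow_semigroup sc(1) C(1) by blast
qed

end

lemma map_type:
  assumes f: "non_elliptic_map f" and K: "koenigs_pair f h \<Omega>"
  shows "hyperbolic_map f \<longleftrightarrow> horizontal_strip (discrete_hull \<Omega>)"
    and "parabolic_pos_step_map f \<longleftrightarrow> horizontal_half_plane (discrete_hull \<Omega>)"
    and "parabolic_zero_step_map f \<longleftrightarrow> discrete_hull \<Omega> = UNIV"
proof -
  have self: "f ` unit_disc \<subseteq> unit_disc" using f unfolding non_elliptic_map_def by blast
  note unique = discrete_hull_type_unique[OF self K]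
  show "hyperbolic_map f \<longleftrightarrow> horizontal_strip (discrete_hull \<Omega>)"
    unfolding hyperbolic_map_def using f K unique(1) by blast
  show "parabolic_pos_step_map f \<longleftrightarrow> horizontal_half_plane (discrete_hull \<Omega>)"
    unfolding parabolic_pos_step_map_def using f K unique(2) by blast
  show "parabolic_zero_step_map f \<longleftrightarrow> discrete_hull \<Omega> = UNIV"
    unfolding parabolic_zero_step_map_def using f K unique(3) by blast
qed

section \<open>The semigroup-fication of a self-map\<close>

locale semigroupfication = linearised_flow V h \<phi> for V h \<phi> +
  fixes f :: "complex \<Rightarrow> complex" and \<tau> :: complex
  assumes f_hol: "f holomorphic_on unit_disc" and f_self: "f ` unit_disc \<subseteq> unit_disc"
    and V_disc: "V \<subseteq> unit_disc" and f_V: "f ` V \<subseteq> V"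
    and h_f: "\<And>z. z \<in> V \<Longrightarrow> h (f z) = h z + 1"
    and dw: "denjoy_wolff_point f \<tau>"
begin

lemma flow_nat: assumes "z \<in> V" shows "\<phi> (real n) z = (f ^^ n) z"
proof -
  have "(f ^^ n) z \<in> V \<and> h ((f ^^ n) z) = h z + of_nat n"
    using assms f_V h_f by (induction n) (auto simp: image_subset_iff)
  then show ?thesis using assms by (intro flow_unique) auto
qed

text \<open>Real time reduces to iteration applied to the first unit of time, which sweeps a compact set.\<close>

lemma flow_split:
  assumes z: "z \<in> V" and t: "t \<ge> 0"
  shows "\<phi> t z = (f ^^ nat \<lfloor>t\<rfloor>) (\<phi> (frac t) z)"
proof -
  have "t = real (nat \<lfloor>t\<rfloor>) + frac t" using t by (simp add: frac_def)
  then have "\<phi> t z = \<phi> (real (nat \<lfloor>t\<rfloor>) + frac t) z" by simp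
  also have "\<dots> = \<phi> (real (nat \<lfloor>t\<rfloor>)) (\<phi> (frac t) z)" using z by (intro flow_add) auto
  also have "\<dots> = (f ^^ nat \<lfloor>t\<rfloor>) (\<phi> (frac t) z)" using z by (intro flow_nat flow_in) auto
  finally show ?thesis .
qed

definition unit_time_sweep where "unit_time_sweep K = (\<lambda>(s, z). \<phi> s z) ` ({0..1} \<times> K)"

lemma unit_time_sweep:
  assumes "compact K" "K \<subseteq> V"
  shows "compact (unit_time_sweep K)" "unit_time_sweep K \<subseteq> unit_disc"
    and "z \<in> K \<Longrightarrow> \<phi> (frac t) z \<in> unit_time_sweep K"
proof -
  show "compact (unit_time_sweep K)" unfolding unit_time_sweep_def using assms
    by (intro compact_continuous_image compact_Times continuous_on_subset[OF flow_continuous]) auto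
  show "unit_time_sweep K \<subseteq> unit_disc"
    unfolding unit_time_sweep_def using assms(2) flow_in V_disc by force
  show "z \<in> K \<Longrightarrow> \<phi> (frac t) z \<in> unit_time_sweep K"
    unfolding unit_time_sweep_def using frac_lt_1[of t]
    by (intro image_eqI[of _ _ "(frac t, z)"]) (auto simp: less_imp_le)
qed

lemma flow_uniform_limit:
  assumes K: "compact K" "K \<subseteq> V" and r: "r > 0"
  shows "\<forall>\<^sub>F t in at_top. \<forall>z\<in>K. dist \<tau> (\<phi> t z) < r"
proof -
  obtain N where N: "\<And>n b. n \<ge> N \<Longrightarrow> b \<in> unit_time_sweep K \<Longrightarrow> dist \<tau> ((f ^^ n) b) < r"
    using iterates_uniform_limit[OF f_hol f_self dw unit_time_sweep(1,2)[OF K] r]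
    unfolding eventually_sequentially by blast
  show ?thesis
    using eventually_ge_at_top[of "real N"]
  proof eventually_elim
    case (elim t)
    have "t \<ge> 0" "nat \<lfloor>t\<rfloor> \<ge> N" using elim by (auto simp: le_nat_floor)
    then show ?case using N unit_time_sweep(3)[OF K] flow_split K(2) by (metis subsetD)
  qed
qed

lemma flow_limit: "z \<in> V \<Longrightarrow> ((\<lambda>t. \<phi> t z) \<longlongrightarrow> \<tau>) at_top"
  using flow_uniform_limit[of "{z}"] by (intro tendstoI) (simp add: dist_commute)

lemma nontangential_iff:
  assumes z: "z \<in> V"
  shows "nontangential_seq (\<lambda>n. (f ^^ n) z) \<tau> \<longleftrightarrow> nontangential_curve (\<lambda>t. \<phi> t z) \<tau>"
proof
  assume nt: "nontangential_seq (\<lambda>n. (f ^^ n) z) \<tau>"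
  have \<tau>: "cmod \<tau> = 1" using dw unfolding denjoy_wolff_point_def by simp
  have zd: "z \<in> unit_disc" using z V_disc by blast
  have K: "compact {z}" "{z} \<subseteq> V" using z by auto
  obtain R where R: "R > 1" "\<And>n b. b \<in> unit_time_sweep {z} \<Longrightarrow> (f ^^ n) b \<in> stolz_region \<tau> R"
    using iterates_in_common_stolz_region[OF f_hol f_self \<tau> zd unit_time_sweep(1,2)[OF K] nt] by blast
  have "\<phi> t z \<in> stolz_region \<tau> R" if "t \<ge> 0" for t
    using R(2) unit_time_sweep(3)[OF K] flow_split[OF z that] by simp
  then show "nontangential_curve (\<lambda>t. \<phi> t z) \<tau>"
    unfolding nontangential_curve_def using flow_limit[OF z] R(1) by blast
next
  assume nt: "nontangential_curve (\<lambda>t. \<phi> t z) \<tau>"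
  then obtain R where R: "R > 1" "\<And>t. t \<ge> 0 \<Longrightarrow> \<phi> t z \<in> stolz_region \<tau> R"
    unfolding nontangential_curve_def by blast
  have "(f ^^ n) z \<in> stolz_region \<tau> R" for n
    using R(2)[of "real n"] flow_nat[OF z] by simp
  moreover have "(\<lambda>n. (f ^^ n) z) \<longlonglongrightarrow> \<tau>"
    using dw z V_disc unfolding denjoy_wolff_point_def by blast
  ultimately show "nontangential_seq (\<lambda>n. (f ^^ n) z) \<tau>"
    unfolding nontangential_seq_def using R(1) by blast
qed

end

theorem theoremB:
  fixes f h :: "complex \<Rightarrow> complex" and \<tau> :: complex and \<Omega> V :: "complex set"
    and \<phi> :: "real \<Rightarrow> complex \<Rightarrow> complex"
  assumes "non_elliptic_map f"
    and "denjoy_wolff_point f \<tau>"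
    and "koenigs_pair f h \<Omega>"
    and "fundamental_domain f V"
    and "univalent_on h V"
    and "starlike_at_infinity (h ` V)"
    and "continuous_hull (h ` V) = discrete_hull \<Omega>"
    and "hyperbolic_map f \<or> parabolic_zero_step_map f \<longrightarrow>
      (\<forall>z::nat \<Rightarrow> complex. nontangential_seq z \<tau> \<longrightarrow>
        (\<forall>\<^sub>F n in sequentially. z n \<in> V) \<and>
        (\<lambda>n. disc_density (z n) / hyperbolic_density V (z n)) \<longlonglongrightarrow> 1)"
    and "\<And>t z. t \<ge> 0 \<Longrightarrow> z \<in> V \<Longrightarrow> \<phi> t z = the_inv_into V h (h z + of_real t)"
  shows "((\<forall>z\<in>V. \<phi> 1 z = f z) \<and> (\<forall>z\<in>V. \<forall>n::nat\<ge>1. \<phi> (real n) z = (f ^^ n) z)) \<and>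
         ((hyperbolic_map f \<longleftrightarrow> hyperbolic_semigroup V \<phi>) \<and>
          (parabolic_zero_step_map f \<longleftrightarrow> parabolic_zero_step_semigroup V \<phi>) \<and>
          (parabolic_pos_step_map f \<longleftrightarrow> parabolic_pos_step_semigroup V \<phi>)) \<and>
         (\<forall>z\<in>V. ((\<lambda>t. cmod (\<phi> t z - \<tau>)) \<longlongrightarrow> 0) at_top) \<and>
         (\<forall>z\<in>V. nontangential_seq (\<lambda>n. (f ^^ n) z) \<tau> \<longleftrightarrow> nontangential_curve (\<lambda>t. \<phi> t z) \<tau>)"
proof -
  have inj: "inj_on h V" using assms(5) unfolding univalent_on_def by blast
  have V: "is_domain V" "simply_connected V" "V \<subseteq> unit_disc" "f ` V \<subseteq> V"
    using assms(4) unfolding fundamental_domain_def by auto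
  have in_image: "h z + of_real t \<in> h ` V" if "z \<in> V" "t \<ge> 0" for z t
    using assms(6) that unfolding starlike_at_infinity_def by blast
  interpret semigroupfication V h \<phi> f \<tau>
  proof
    show "\<phi> t z \<in> V" if "z \<in> V" "t \<ge> 0" for z t
      using assms(9)[OF that(2,1)] the_inv_into_into[OF inj in_image[OF that] order_refl] by simp
    show "h (\<phi> t z) = h z + of_real t" if "z \<in> V" "t \<ge> 0" for z t
      using assms(9)[OF that(2,1)] f_the_inv_into_f[OF inj in_image[OF that]] by simp
    show "f holomorphic_on unit_disc" "f ` unit_disc \<subseteq> unit_disc"
      using assms(1) unfolding non_elliptic_map_def by auto
    show "h (f z) = h z + 1" if "z \<in> V" for z
      using assms(3) that V(3) unfolding koenigs_pair_def by blast
  qed (use V assms(2,5) in auto)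
  have "\<tau> \<in> sphere 0 1" using assms(2) unfolding denjoy_wolff_point_def by blast
  then have ne: "non_elliptic_semigroup V \<phi>"
    using flow_converges_to_prime_end V flow_uniform_limit by blast
  have "bounded V" using V(3) bounded_ball bounded_subset by blast
  then have "h ` V \<noteq> UNIV" by (rule image_not_UNIV)
  note types = map_type[OF assms(1,3)] semigroup_type[OF assms(6) ne this, unfolded assms(7)]
  have "\<forall>z\<in>V. \<phi> 1 z = f z" using flow_nat[of _ 1] by simp
  moreover have "\<forall>z\<in>V. ((\<lambda>t. cmod (\<phi> t z - \<tau>)) \<longlongrightarrow> 0) at_top"
    using flow_limit by (simp add: LIM_zero tendsto_norm_zero)
  ultimately show ?thesis
    using flow_nat types nontangential_iff by blast
qed

end
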